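(* Let $J$ be as in the context. Let $u_0\in L^\infty(\mathbb R^N)$, $u_0\ge0$, be such that $|x|^\alpha u_0(x)\to A$ as $|x|\to\infty$, with $\alpha>0$ and $A>0$. Let $p>1$ and let $u$ be the solution to $$u_t(x,t)=\int_{\mathbb R^N} J(x-y)\big(u(y,t)-u(x,t)\big)\,dy-u^p(x,t)\quad\text{in }\mathbb R^N\times(0,\infty),\qquad u(x,0)=u_0(x).$$ Then: (1) For every $T<\infty$ there exists a constant $C_T$ such that $u(x,t)\le C_T(1+|x|)^{-\alpha}$ for all $x\in\mathbb R^N$ and $0\le t\le T$. (2) If $\alpha<N$, there exists a constant $C$ such that $u(x,t)\le Ct^{-\alpha/2}$ for all $x\in\mathbb R^N$, $t>0$. If $\alpha=N$, there exists a constant $C$ such that $u(x,t)\le Ct^{-N/2}\log t$ for all $x\in\mathbb R^N$, $t\ge2$. (3) For every $t>0$, $|x|^\alpha u(x,t)\to A$ as $|x|\to\infty$, uniformly for $t$ in bounded sets.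
   Context: $J\in C_0^\infty(\mathbb R^N)$ (smooth with compact support) is radially symmetric, $J\ge0$, $\int_{\mathbb R^N} J=1$. The solution $u$ is the unique nonnegative bounded solution: a bounded measurable function on $\mathbb R^N\times[0,\infty)$ that, for each $x$, is $C^1$ in $t$ and satisfies the equation and the initial condition. The conditions on $u_0$ are understood pointwise for $u_0$ as a bounded measurable function. *)

theory Defs
  imports "HOL-Analysis.Analysis"
begin

(* C^k on the whole space: the iterated directional derivatives in all directions exist and
   are continuous. *)
primrec C_k :: "nat \<Rightarrow> (real ^ 'n \<Rightarrow> real) \<Rightarrow> bool" where
  "C_k 0 f \<longleftrightarrow> continuous_on UNIV f"
| "C_k (Suc k) f \<longleftrightarrow>
     (\<forall>x. f differentiable (at x)) \<and> (\<forall>v. C_k k (\<lambda>x. frechet_derivative f (at x) v))"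

definition smooth :: "(real ^ 'n \<Rightarrow> real) \<Rightarrow> bool" where
  "smooth f \<longleftrightarrow> (\<forall>k. C_k k f)"

definition compactly_supported :: "(real ^ 'n \<Rightarrow> real) \<Rightarrow> bool" where
  "compactly_supported f \<longleftrightarrow> compact (closure {x. f x \<noteq> 0})"

definition radially_symmetric :: "(real ^ 'n \<Rightarrow> real) \<Rightarrow> bool" where
  "radially_symmetric f \<longleftrightarrow> (\<forall>x y. norm x = norm y \<longrightarrow> f x = f y)"

definition dispersal_kernel :: "(real ^ 'n \<Rightarrow> real) \<Rightarrow> bool" where
  "dispersal_kernel J \<longleftrightarrow>
     smooth J \<and> compactly_supported J \<and> radially_symmetric J \<and> (\<forall>x. J x \<ge> 0) \<and>
     integrable lebesgue J \<and> (LINT x|lebesgue. J x) = 1"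

(* C^1 on the closed half-line [0,\<infinity>), with the one-sided derivative at 0; values at negative
   arguments are irrelevant. *)
definition C1_on_halfline :: "(real \<Rightarrow> real) \<Rightarrow> bool" where
  "C1_on_halfline f \<longleftrightarrow>
     (\<exists>f'. (\<forall>t\<ge>0. (f has_real_derivative f' t) (at t within {0..})) \<and> continuous_on {0..} f')"

(* The nonnegative bounded solution; u is only constrained for times t \<ge> 0. *)
definition is_solution ::
  "(real ^ 'n \<Rightarrow> real) \<Rightarrow> real \<Rightarrow> (real ^ 'n \<Rightarrow> real) \<Rightarrow> (real ^ 'n \<Rightarrow> real \<Rightarrow> real) \<Rightarrow> bool" where
  "is_solution J p u0 u \<longleftrightarrow>
     (\<lambda>(x, t). u x t) \<in> borel_measurable (lebesgue_on (UNIV \<times> {0..})) \<and>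
     (\<forall>x. \<forall>t\<ge>0. u x t \<ge> 0) \<and>
     (\<exists>M. \<forall>x. \<forall>t\<ge>0. u x t \<le> M) \<and>
     (\<forall>x. C1_on_halfline (u x)) \<and>
     (\<forall>x. \<forall>t>0. (u x has_real_derivative
         (LINT y|lebesgue. J (x - y) * (u y t - u x t)) - u x t powr p) (at t)) \<and>
     (\<forall>x. u x 0 = u0 x)"

end

theory Submission
  imports Defs
begin

text \<open>
  Write \<open>J * f\<close> for the convolution.  Since the absorption term is nonnegative, \<open>V = e\<^sup>t u\<close>
  satisfies \<open>V\<^sub>t \<le> J * V\<close>.  Iterating Duhamel's formula, starting from a constant upper bound for
  \<open>V\<close>, shows that if \<open>u\<^sub>0 \<le> h\<^sub>0\<close> and \<open>J * h\<^sub>k \<le> h\<^bsub>k+1\<^esub>\<close>, then \<open>V\<close> is at most the sum of all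
  \<open>t\<^sup>k / k! \<cdot> h\<^sub>k\<close>, because the remainder is a multiple of \<open>t\<^sup>n / n!\<close> (\<open>dispersal_comparison\<close>).
  What remains is to choose the majorants \<open>h\<^sub>k\<close>.

  For the bound on finite time intervals let \<open>w\<close> be \<open>1 + |x|\<close> to the power \<open>-\<alpha>\<close>.  The kernel has
  bounded support, so \<open>J * w \<le> K w\<close>, and \<open>h\<^sub>k\<close> may be taken to be a multiple of \<open>K\<^sup>k w\<close>.

  For the decay in time, the datum is split at a dyadic radius of order \<open>\<surd>t\<close>.  Outside, it is
  bounded by a constant of order \<open>t\<close> to the power \<open>-\<alpha>/2\<close>, and constants are preserved by
  \<open>J *\<close>.  Inside, it is integrable, and the \<open>L\<^sup>1\<close>-\<open>L\<^sup>\<infinity>\<close> estimate \<open>dispersal_smoothing\<close> gains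
  \<open>t\<close> to the power \<open>-N/2\<close>; the mass of \<open>w\<close> in the ball of radius \<open>\<surd>t\<close> then yields the exponent for
  \<open>\<alpha> < N\<close> and the logarithm for \<open>\<alpha> = N\<close>.  The smoothing estimate rests on dominating \<open>J\<close> by a multiple
  of the Fejer-type kernel \<open>|\<integral>\<^sub>Q e\<^bsup>i\<xi>z\<^esup> d\<xi>|\<^sup>2\<close> with \<open>Q\<close> a small ball.  This kernel is
  nonnegative, and it is a superposition of plane waves whose frequencies all lie near \<open>0\<close>.  Plane waves
  are eigenfunctions of \<open>J *\<close>, and for small \<open>\<zeta>\<close> the Fourier transform of \<open>J\<close> lies between \<open>1/2\<close>
  and \<open>1 - c |\<zeta>|\<^sup>2\<close>, so the iterates of \<open>J *\<close> are controlled by the Gaussian integral of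
  \<open>exp (- c t |\<zeta>|\<^sup>2)\<close>.  No Fourier inversion is involved.

  For the asymptotics in space, \<open>u - A w\<close> solves a linear equation up to a source that is \<open>o(w)\<close>
  at infinity: \<open>(J * w) / w\<close> tends to \<open>1\<close>, and \<open>u\<^sup>p\<close> is at most of order \<open>w\<^sup>p\<close>.  Such a source is at most
  \<open>\<epsilon> w\<close> plus a multiple of \<open>w / (1 + |x|)\<close>, and comparison carries this bound over to
  \<open>u - A w\<close> (\<open>solution_near_profile\<close>).
\<close>

section \<open>Point reflections of Lebesgue measure\<close>

lemma lborel_reflect:
  fixes x :: "'a::euclidean_space"
  shows "distr lborel borel (\<lambda>y. x - y) = lborel"
  by (subst (2) lborel_affine[of "-1" x]) (simp_all add: density_1)

lemma lborel_integral_reflect: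
  fixes x :: "'a::euclidean_space" and f :: "'a \<Rightarrow> real"
  assumes [measurable]: "f \<in> borel_measurable borel"
  shows "(LINT y|lborel. f (x - y)) = (LINT y|lborel. f y)"
proof -
  have "(LINT y|lborel. f y) = (LINT y|distr lborel borel (\<lambda>y. x - y). f y)"
    by (simp add: lborel_reflect)
  also have "\<dots> = (LINT y|lborel. f (x - y))"
    by (subst integral_distr) auto
  finally show ?thesis by simp
qed

lemma lborel_integrable_reflect:
  fixes x :: "'a::euclidean_space" and f :: "'a \<Rightarrow> real"
  assumes "integrable lborel f"
  shows "integrable lborel (\<lambda>y. f (x - y))"
proof -
  have "integrable (distr lborel borel (\<lambda>y. x - y)) f"
    using assms by (simp add: lborel_reflect)
  then show ?thesis
    by (subst (asm) integrable_distr_eq) (use assms borel_measurable_integrable in auto)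
qed

section \<open>The averaging operator of a dispersal kernel\<close>

text \<open>A class of functions on which convolution with the kernel is defined, additive and monotone.
  Measurability is Lebesgue rather than Borel because the time slices of a solution need not be Borel.\<close>

definition bounded_measurable :: "('a::euclidean_space \<Rightarrow> real) \<Rightarrow> bool" where
  "bounded_measurable f \<longleftrightarrow> f \<in> borel_measurable lebesgue \<and> (\<exists>B. \<forall>x. \<bar>f x\<bar> \<le> B)"

lemma bounded_measurableI:
  "f \<in> borel_measurable lebesgue \<Longrightarrow> (\<And>x. \<bar>f x\<bar> \<le> B) \<Longrightarrow> bounded_measurable f"
  by (auto simp: bounded_measurable_def)

lemma bounded_measurable_const: "bounded_measurable (\<lambda>x. c)"
  by (auto simp: bounded_measurable_def)

lemma bounded_measurable_cmult:
  assumes "bounded_measurable f" shows "bounded_measurable (\<lambda>x. c * f x)"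
proof -
  from assms obtain B where B: "f \<in> borel_measurable lebesgue" "\<And>x. \<bar>f x\<bar> \<le> B"
    by (auto simp: bounded_measurable_def)
  have "\<bar>c * f x\<bar> \<le> \<bar>c\<bar> * B" for x
    by (simp add: abs_mult mult_left_mono B)
  with B show ?thesis
    by (intro bounded_measurableI[where B = "\<bar>c\<bar> * B"]) auto
qed

lemma bounded_measurable_add:
  assumes "bounded_measurable f" "bounded_measurable g"
  shows "bounded_measurable (\<lambda>x. f x + g x)"
proof -
  from assms obtain B C where B: "f \<in> borel_measurable lebesgue" "\<And>x. \<bar>f x\<bar> \<le> B"
    and C: "g \<in> borel_measurable lebesgue" "\<And>x. \<bar>g x\<bar> \<le> C"
    by (auto simp: bounded_measurable_def)
  have "\<bar>f x + g x\<bar> \<le> B + C" for x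
    using B(2)[of x] C(2)[of x] by linarith
  with B C show ?thesis
    by (intro bounded_measurableI[where B = "B + C"]) auto
qed

lemma bounded_measurable_diff:
  assumes "bounded_measurable f" "bounded_measurable g"
  shows "bounded_measurable (\<lambda>x. f x - g x)"
  using bounded_measurable_add[OF assms(1) bounded_measurable_cmult[OF assms(2), of "-1"]] by simp

lemma bounded_measurable_sum:
  assumes "finite I" "\<And>i. i \<in> I \<Longrightarrow> bounded_measurable (f i)"
  shows "bounded_measurable (\<lambda>x. \<Sum>i\<in>I. f i x)"
  using assms by (induction I rule: finite_induct)
    (auto intro: bounded_measurable_const bounded_measurable_add)

locale dispersal =
  fixes J :: "real ^ 'n \<Rightarrow> real"
  assumes kernel: "dispersal_kernel J"
begin

lemma J_nonneg: "J x \<ge> 0"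
  using kernel by (auto simp: dispersal_kernel_def)

lemma J_even: "J (- x) = J x"
  using kernel norm_minus_cancel[of x] unfolding dispersal_kernel_def radially_symmetric_def by blast

lemma continuous_J: "continuous_on UNIV J"
  using kernel C_k.simps(1)[of J] unfolding dispersal_kernel_def smooth_def by blast

lemma J_measurable [measurable]: "J \<in> borel_measurable borel"
  using continuous_J by (rule borel_measurable_continuous_onI)

lemma J_integrable: "integrable lborel J"
  using kernel by (auto simp: dispersal_kernel_def integrable_completion)

lemma J_integral: "(LINT x|lborel. J x) = 1"
  using kernel by (auto simp: dispersal_kernel_def integral_completion)

lemma J_support: obtains R where "R \<ge> 1" "\<And>x. J x \<noteq> 0 \<Longrightarrow> norm x \<le> R"
proof -
  have "bounded (closure {x. J x \<noteq> 0})"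
    using kernel by (auto simp: dispersal_kernel_def compactly_supported_def compact_imp_bounded)
  then obtain b where "\<And>x. x \<in> closure {x. J x \<noteq> 0} \<Longrightarrow> norm x \<le> b"
    by (auto simp: bounded_iff)
  then have "norm x \<le> max 1 b" if "J x \<noteq> 0" for x
    using that closure_subset[of "{x. J x \<noteq> 0}"] by (meson in_mono max.coboundedI2 mem_Collect_eq)
  then show ?thesis
    by (intro that[of "max 1 b"]) auto
qed

text \<open>Some radius of a ball about the origin containing the support of the kernel, fixed once and for
  all.  It is at least \<open>1\<close> so that products and quotients with it need no case distinction.\<close>

definition radius :: real where
  "radius = (SOME R. R \<ge> 1 \<and> (\<forall>x. J x \<noteq> 0 \<longrightarrow> norm x \<le> R))"

lemma radius: "radius \<ge> 1" "J x \<noteq> 0 \<Longrightarrow> norm x \<le> radius"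
proof -
  have "\<exists>R. R \<ge> 1 \<and> (\<forall>x. J x \<noteq> 0 \<longrightarrow> norm x \<le> R)"
    using J_support by blast
  from someI_ex[OF this] show "radius \<ge> 1" "J x \<noteq> 0 \<Longrightarrow> norm x \<le> radius"
    unfolding radius_def by blast+
qed

lemma J_bounded: obtains B where "B > 0" "\<And>x. J x \<le> B"
proof -
  have "compact (J ` cball 0 radius)"
    by (intro compact_continuous_image continuous_on_subset[OF continuous_J]) auto
  then have "bounded (J ` cball 0 radius)" by (rule compact_imp_bounded)
  then obtain b where b: "\<And>x. norm x \<le> radius \<Longrightarrow> \<bar>J x\<bar> \<le> b"
    by (metis bounded_iff image_eqI mem_cball_0 real_norm_def)
  have "J x \<le> max 1 b" for x
    using radius(2)[of x] b[of x] by (cases "J x = 0") (auto simp: le_max_iff_disj)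
  then show ?thesis by (intro that[of "max 1 b"]) auto
qed

text \<open>The convolution \<open>J * f\<close>.  The equation reads \<open>u\<^sub>t = J * u - u - u\<^sup>p\<close>, as \<open>J\<close> has integral \<open>1\<close>.\<close>

definition disperse :: "(real ^ 'n \<Rightarrow> real) \<Rightarrow> real ^ 'n \<Rightarrow> real" where
  "disperse f x = (LINT y|lebesgue. J (x - y) * f y)"

lemma disperse_lborel:
  assumes [measurable]: "f \<in> borel_measurable borel"
  shows "disperse f x = (LINT y|lborel. J (x - y) * f y)"
  unfolding disperse_def by (rule integral_completion) measurable

lemma disperse_convolution:
  assumes [measurable]: "f \<in> borel_measurable borel"
  shows "disperse f x = (LINT z|lborel. J z * f (x - z))"
  using lborel_integral_reflect[of "\<lambda>z. J z * f (x - z)" x] by (simp add: disperse_lborel)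

lemma J_shift_measurable: "(\<lambda>y. J (x - y)) \<in> borel_measurable lebesgue"
  by (rule measurable_completion) measurable

lemma J_shift_integrable: "integrable lebesgue (\<lambda>y. J (x - y))"
  by (subst integrable_completion) (auto intro: lborel_integrable_reflect J_integrable)

lemma disperse_integrable:
  assumes "bounded_measurable f"
  shows "integrable lebesgue (\<lambda>y. J (x - y) * f y)"
proof -
  from assms obtain B where B: "f \<in> borel_measurable lebesgue" "\<And>x. \<bar>f x\<bar> \<le> B"
    by (auto simp: bounded_measurable_def)
  show ?thesis
  proof (rule Bochner_Integration.integrable_bound)
    show "integrable lebesgue (\<lambda>y. B * J (x - y))"
      using J_shift_integrable by simp
    show "(\<lambda>y. J (x - y) * f y) \<in> borel_measurable lebesgue"
      using B J_shift_measurable by simp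
    show "AE y in lebesgue. norm (J (x - y) * f y) \<le> norm (B * J (x - y))"
    proof (intro AE_I2)
      fix y
      have "\<bar>f y\<bar> * J (x - y) \<le> \<bar>B\<bar> * J (x - y)"
        using B(2)[of y] by (intro mult_right_mono J_nonneg) linarith
      then show "norm (J (x - y) * f y) \<le> norm (B * J (x - y))"
        by (simp add: abs_mult J_nonneg mult.commute)
    qed
  qed
qed

lemma disperse_const: "disperse (\<lambda>y. c) x = c"
proof -
  have "disperse (\<lambda>y. c) x = (LINT z|lborel. J z * c)"
    by (rule disperse_convolution) simp
  also have "\<dots> = c" using J_integral by simp
  finally show ?thesis .
qed

lemma disperse_cmult: "disperse (\<lambda>y. c * f y) x = c * disperse f x"
  by (simp add: disperse_def mult.left_commute)

lemma disperse_add: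
  assumes "bounded_measurable f" "bounded_measurable g"
  shows "disperse (\<lambda>y. f y + g y) x = disperse f x + disperse g x"
  unfolding disperse_def using disperse_integrable assms by (simp add: distrib_left)

lemma disperse_diff:
  assumes "bounded_measurable f" "bounded_measurable g"
  shows "disperse (\<lambda>y. f y - g y) x = disperse f x - disperse g x"
  unfolding disperse_def using disperse_integrable assms by (simp add: right_diff_distrib)

lemma disperse_sum:
  assumes "finite I" "\<And>i. i \<in> I \<Longrightarrow> bounded_measurable (f i)"
  shows "disperse (\<lambda>x. \<Sum>i\<in>I. f i x) x = (\<Sum>i\<in>I. disperse (f i) x)"
  using assms by (induction I rule: finite_induct)
    (auto simp: disperse_const disperse_add bounded_measurable_sum)

text \<open>Only the values within distance \<open>radius\<close> of \<open>x\<close> matter; this locality gives all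
  comparisons of weights with their convolutions.\<close>

lemma disperse_mono:
  assumes "bounded_measurable f" "bounded_measurable g"
    and "\<And>y. norm (x - y) \<le> radius \<Longrightarrow> f y \<le> g y"
  shows "disperse f x \<le> disperse g x"
  unfolding disperse_def
proof (rule integral_mono)
  fix y
  show "J (x - y) * f y \<le> J (x - y) * g y"
    using assms(3)[of y] radius(2)[of "x - y"] J_nonneg[of "x - y"]
    by (cases "J (x - y) = 0") (auto intro: mult_left_mono)
qed (use disperse_integrable assms in auto)

text \<open>Iterated Duhamel formula.  If the claim with \<open>n\<close> terms holds at all earlier times, then
  inserting it into \<open>V\<^sub>t \<le> J * V\<close> bounds \<open>V\<^sub>t\<close> by the time derivative of the right-hand side with
  \<open>n + 1\<close> terms.\<close>

lemma dispersal_comparison: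
  fixes V :: "real ^ 'n \<Rightarrow> real \<Rightarrow> real"
  assumes V_meas: "\<And>t. 0 \<le> t \<Longrightarrow> t \<le> T \<Longrightarrow> bounded_measurable (\<lambda>x. V x t)"
    and V_cont: "\<And>x. continuous_on {0..T} (V x)"
    and V_deriv: "\<And>x t. 0 < t \<Longrightarrow> t < T \<Longrightarrow>
      \<exists>D. (V x has_real_derivative D) (at t) \<and> D \<le> disperse (\<lambda>y. V y t) x"
    and V_bound: "\<And>x t. 0 \<le> t \<Longrightarrow> t \<le> T \<Longrightarrow> V x t \<le> M"
    and V_init: "\<And>x. V x 0 \<le> h 0 x"
    and h_meas: "\<And>k. bounded_measurable (h k)"
    and h_step: "\<And>k x. disperse (h k) x \<le> h (Suc k) x"
    and t: "0 \<le> t" "t \<le> T"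
  shows "V x t \<le> (\<Sum>k<n. t ^ k / fact k * h k x) + M * t ^ n / fact n"
  using t
proof (induction n arbitrary: x t)
  case 0
  then show ?case using V_bound by simp
next
  case (Suc n)
  define S where "S t x = (\<Sum>k<n. t ^ k / fact k * h k x) + M * t ^ n / fact n" for t x
  \<comment> \<open>The difference of the two sides, which is nonnegative at time \<open>0\<close> and nondecreasing.\<close>
  define \<phi> where
    "\<phi> s = (\<Sum>k<Suc n. s ^ k / fact k * h k x) + M * s ^ Suc n / fact (Suc n) - V x s" for s
  have "\<phi> 0 \<le> \<phi> t"
  proof (rule DERIV_nonneg_imp_increasing_open[of 0 t \<phi>])
    show "0 \<le> t" by fact
    show "continuous_on {0..t} \<phi>"
      unfolding \<phi>_def using Suc.prems
      by (intro continuous_intros continuous_on_subset[OF V_cont]) auto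
    fix s assume s: "0 < s" "s < t"
    then obtain D where D: "(V x has_real_derivative D) (at s)" "D \<le> disperse (\<lambda>y. V y s) x"
      using V_deriv[of s x] Suc.prems by auto
    have deriv_pow: "((\<lambda>s. s ^ Suc k / fact (Suc k) * c) has_real_derivative
        s ^ k / fact k * c) (at s)" for k c
    proof -
      have "((\<lambda>s. c / fact (Suc k) * s ^ Suc k) has_real_derivative
          c / fact (Suc k) * (real (Suc k) * s ^ k)) (at s)"
        using DERIV_cmult[OF DERIV_pow[of "Suc k" s], of "c / fact (Suc k)"] by simp
      moreover have "c / fact (Suc k) * (real (Suc k) * s ^ k) = s ^ k / fact k * c"
        by (simp add: fact_Suc del: of_nat_Suc)
      ultimately show ?thesis by (simp add: mult.commute)
    qed
    have "((\<lambda>s. (\<Sum>k<n. s ^ Suc k / fact (Suc k) * h (Suc k) x) + h 0 x) has_real_derivative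
        (\<Sum>k<n. s ^ k / fact k * h (Suc k) x) + 0) (at s)"
      by (intro DERIV_add DERIV_sum deriv_pow DERIV_const)
    then have "((\<lambda>s. \<Sum>k<Suc n. s ^ k / fact k * h k x) has_real_derivative
        (\<Sum>k<n. s ^ k / fact k * h (Suc k) x)) (at s)"
      unfolding sum.lessThan_Suc_shift by (simp add: add.commute)
    moreover have "((\<lambda>s. M * s ^ Suc n / fact (Suc n)) has_real_derivative M * s ^ n / fact n) (at s)"
      using deriv_pow[of n M] by (simp add: mult.commute)
    ultimately have "(\<phi> has_real_derivative
        (\<Sum>k<n. s ^ k / fact k * h (Suc k) x) + M * s ^ n / fact n - D) (at s)"
      unfolding \<phi>_def using D(1) by (intro DERIV_diff DERIV_add)
    moreover have "D \<le> (\<Sum>k<n. s ^ k / fact k * h (Suc k) x) + M * s ^ n / fact n"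
    proof -
      have bm: "bounded_measurable (\<lambda>y. \<Sum>k<n. s ^ k / fact k * h k y)"
        by (intro bounded_measurable_sum bounded_measurable_cmult h_meas) auto
      have "D \<le> disperse (\<lambda>y. V y s) x" by (rule D)
      also have "\<dots> \<le> disperse (S s) x"
      proof (rule disperse_mono)
        show "bounded_measurable (\<lambda>y. V y s)"
          using V_meas[of s] s Suc.prems by auto
        show "bounded_measurable (S s)"
          unfolding S_def by (intro bounded_measurable_add bm bounded_measurable_const)
        show "V y s \<le> S s y" for y
          unfolding S_def using Suc.IH[of s y] s Suc.prems by auto
      qed
      also have "\<dots> = (\<Sum>k<n. s ^ k / fact k * disperse (h k) x) + M * s ^ n / fact n"
        unfolding S_def
        by (simp add: disperse_add[OF bm bounded_measurable_const] disperse_const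
            disperse_sum bounded_measurable_cmult h_meas disperse_cmult del: times_divide_eq_left)
      also have "\<dots> \<le> (\<Sum>k<n. s ^ k / fact k * h (Suc k) x) + M * s ^ n / fact n"
        using s by (intro add_right_mono sum_mono mult_left_mono h_step) auto
      finally show ?thesis .
    qed
    ultimately show "\<exists>y. (\<phi> has_real_derivative y) (at s) \<and> 0 \<le> y" by auto
  qed
  moreover have "\<phi> 0 = h 0 x - V x 0"
    unfolding \<phi>_def sum.lessThan_Suc_shift by simp
  ultimately show ?case
    using V_init[of x] unfolding \<phi>_def by simp
qed

text \<open>The remainder of the iteration vanishes as the number of terms grows.  With \<open>h = 0\<close> and \<open>E = 0\<close>
  this is the maximum principle for bounded subsolutions of \<open>V\<^sub>t = J * V\<close>.\<close>

lemma dispersal_comparison_limit: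
  fixes V :: "real ^ 'n \<Rightarrow> real \<Rightarrow> real"
  assumes "\<And>t. 0 \<le> t \<Longrightarrow> t \<le> T \<Longrightarrow> bounded_measurable (\<lambda>x. V x t)"
    and "\<And>x. continuous_on {0..T} (V x)"
    and "\<And>x t. 0 < t \<Longrightarrow> t < T \<Longrightarrow>
      \<exists>D. (V x has_real_derivative D) (at t) \<and> D \<le> disperse (\<lambda>y. V y t) x"
    and "\<And>x t. 0 \<le> t \<Longrightarrow> t \<le> T \<Longrightarrow> V x t \<le> M"
    and "\<And>x. V x 0 \<le> h 0 x"
    and "\<And>k. bounded_measurable (h k)"
    and "\<And>k x. disperse (h k) x \<le> h (Suc k) x"
    and "0 \<le> t" "t \<le> T"
    and E: "\<And>n. (\<Sum>k<n. t ^ k / fact k * h k x) \<le> E"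
  shows "V x t \<le> E"
proof (rule LIMSEQ_le_const)
  have "(\<lambda>n. t ^ n / fact n) \<longlonglongrightarrow> 0"
    using summable_LIMSEQ_zero[OF summable_exp[of t]] by (simp add: divide_inverse mult.commute)
  then have "(\<lambda>n. E + M * (t ^ n / fact n)) \<longlonglongrightarrow> E + M * 0"
    by (intro tendsto_intros)
  then show "(\<lambda>n. E + M * (t ^ n / fact n)) \<longlonglongrightarrow> E" by simp
  show "\<exists>N. \<forall>n\<ge>N. V x t \<le> E + M * (t ^ n / fact n)"
  proof (intro exI allI impI)
    fix n :: nat
    show "V x t \<le> E + M * (t ^ n / fact n)"
      using dispersal_comparison[where V = V and T = T and M = M and h = h and n = n and x = x
          and t = t, OF assms(1-9)] E[of n] by simp
  qed
qed

end

section \<open>Elementary estimates and Gaussian integrals\<close>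

lemma cos_lower_bound: "cos s \<ge> 1 - s\<^sup>2 / 2" for s :: real
proof -
  have "(sin (s/2))\<^sup>2 \<le> (s/2)\<^sup>2"
    using abs_sin_x_le_abs_x[of "s/2"] by (simp only: abs_le_square_iff)
  then show ?thesis
    using cos_double_sin[of "s/2"] by (simp add: power_divide)
qed

text \<open>A quadratic upper bound follows from \<open>sin x \<ge> x / 2\<close> on \<open>[0, 1]\<close>.\<close>

lemma cos_upper_bound:
  assumes "\<bar>s\<bar> \<le> (1::real)"
  shows "cos s \<le> 1 - s\<^sup>2 / 8"
proof -
  have sin_lower: "sin x \<ge> x / 2" if "0 \<le> x" "x \<le> 1" for x :: real
  proof -
    have "sin 0 - 0 / 2 \<le> sin x - x / 2"
    proof (rule DERIV_nonneg_imp_nondecreasing[OF that(1), of "\<lambda>x. sin x - x / 2"])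
      fix y :: real assume y: "0 \<le> y" "y \<le> x"
      have "((\<lambda>x. sin x - x / 2) has_real_derivative cos y - 1 / 2) (at y)"
        by (auto intro!: derivative_eq_intros)
      moreover have "y\<^sup>2 \<le> 1" using y that by (simp add: power_le_one)
      ultimately show "\<exists>D. ((\<lambda>x. sin x - x / 2) has_real_derivative D) (at y) \<and> 0 \<le> D"
        using cos_lower_bound[of y] by (intro exI[of _ "cos y - 1/2"]) auto
    qed
    then show ?thesis by simp
  qed
  have "\<bar>s\<bar> / 4 \<le> \<bar>sin (s/2)\<bar>"
    using sin_lower[of "s/2"] sin_lower[of "-s/2"] assms by (cases "s \<ge> 0") auto
  then have "(\<bar>s\<bar> / 4)\<^sup>2 \<le> \<bar>sin (s/2)\<bar>\<^sup>2" by (intro power_mono) auto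
  then show ?thesis
    using cos_double_sin[of "s/2"] by (simp add: power_divide)
qed

lemma sum_exp_le_exp:
  assumes "(x::real) \<ge> 0"
  shows "(\<Sum>k<n. x ^ k / fact k) \<le> exp x"
proof -
  have "(\<Sum>k<n. x ^ k / fact k) \<le> (\<Sum>k. x ^ k / fact k)"
    using summable_exp[of x] assms by (intro sum_le_suminf) (auto simp: divide_inverse mult.commute)
  also have "\<dots> = exp x"
    by (simp add: exp_def divide_inverse mult.commute)
  finally show ?thesis .
qed

lemma sum_exp_le_exp_Suc:
  assumes "(x::real) \<ge> 0"
  shows "(\<Sum>k<n. x ^ Suc k / fact (Suc k)) \<le> exp x"
proof -
  have "(\<Sum>k<n. x ^ Suc k / fact (Suc k)) \<le> (\<Sum>k<Suc n. x ^ k / fact k)"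
    unfolding sum.lessThan_Suc_shift by simp
  also have "\<dots> \<le> exp x" using assms by (rule sum_exp_le_exp)
  finally show ?thesis .
qed

lemma lborel_product_integral:
  fixes f :: "'a::euclidean_space \<Rightarrow> real" and g :: "'b::euclidean_space \<Rightarrow> real"
  assumes f: "integrable lborel f" and g: "integrable lborel g"
  shows "integrable lborel (\<lambda>(x, y). f x * g y)"
    and "(LINT q|lborel. (case q of (x, y) \<Rightarrow> f x * g y)) = (LINT x|lborel. f x) * (LINT y|lborel. g y)"
proof -
  have [measurable]: "f \<in> borel_measurable borel" "g \<in> borel_measurable borel"
    using f g borel_measurable_integrable by fastforce+
  have int: "integrable (lborel \<Otimes>\<^sub>M lborel) (\<lambda>(x, y). f x * g y)"
    by (rule lborel_pair.Fubini_integrable) (use f g in \<open>auto simp: abs_mult\<close>)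
  then show "integrable lborel (\<lambda>(x, y). f x * g y)" by (simp add: lborel_prod)
  from lborel_pair.integral_fst[OF int]
  show "(LINT q|lborel. (case q of (x, y) \<Rightarrow> f x * g y)) = (LINT x|lborel. f x) * (LINT y|lborel. g y)"
    by (simp add: lborel_prod)
qed

text \<open>The balls of radius \<open>(j + 1) / \<surd>t\<close> cover the space, and on the \<open>j\<close>-th shell the integrand is
  at most \<open>exp (- c j\<^sup>2) \<le> exp (- c j)\<close>.  The volumes contribute the factor \<open>t\<close> to the power
  \<open>-N/2\<close> times \<open>(j + 1)\<^sup>N\<close>, and the resulting series converges.\<close>

lemma gaussian_integral_decay:
  assumes c: "c > 0"
  obtains K where "K \<ge> 0"
    "\<And>t. t > 0 \<Longrightarrow> integrable lborel (\<lambda>\<zeta>::'a::euclidean_space. exp (- (c * t * (norm \<zeta>)\<^sup>2)))"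
    "\<And>t. t > 0 \<Longrightarrow> (LINT \<zeta>|lborel. exp (- (c * t * (norm (\<zeta>::'a))\<^sup>2))) \<le> K * t powr (- real DIM('a) / 2)"
proof -
  define N where "N = DIM('a)"
  define V where "V = unit_ball_vol (real N)"
  have V: "V \<ge> 0" by (simp add: V_def)
  define a where "a j = exp (- (c * real j)) * real (Suc j) ^ N" for j
  \<comment> \<open>Comparison with \<open>(j + 1)\<^bsup>-2\<^esup>\<close>, using one term of the exponential series.\<close>
  have "summable a"
  proof (rule summable_comparison_test')
    show "summable (\<lambda>j. exp c * (fact (N + 2) / c ^ (N + 2)) * inverse (real (Suc j) ^ 2))"
      using inverse_power_summable[of 2, where 'a = real]
      by (intro summable_mult) (subst summable_Suc_iff[where f = "\<lambda>j. inverse (real j ^ 2)"], simp)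
    fix j :: nat
    have pos: "c * real (Suc j) > 0" using c by (intro mult_pos_pos) auto
    have "(c * real (Suc j)) ^ (N + 2) / fact (N + 2) \<le> (\<Sum>k<Suc (N + 2). (c * real (Suc j)) ^ k / fact k)"
      by (rule member_le_sum) (use pos in auto)
    also have "\<dots> \<le> exp (c * real (Suc j))"
      using pos by (intro sum_exp_le_exp) simp
    finally have le: "(c * real (Suc j)) ^ (N + 2) / fact (N + 2) \<le> exp (c * real (Suc j))" .
    have "exp (- (c * real (Suc j))) = 1 / exp (c * real (Suc j))" by (simp add: exp_minus divide_inverse)
    also have "\<dots> \<le> 1 / ((c * real (Suc j)) ^ (N + 2) / fact (N + 2))"
      using pos le c by (intro divide_left_mono mult_pos_pos divide_pos_pos zero_less_power) auto
    also have "\<dots> = fact (N + 2) / c ^ (N + 2) * inverse (real (Suc j) ^ (N + 2))"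
      by (simp add: power_mult_distrib field_simps del: of_nat_Suc)
    finally have e: "exp (- (c * real (Suc j))) \<le> fact (N + 2) / c ^ (N + 2) * inverse (real (Suc j) ^ (N + 2))" .
    have "a j = exp c * exp (- (c * real (Suc j))) * real (Suc j) ^ N"
      by (simp add: a_def distrib_left flip: exp_add)
    also have "\<dots> \<le> exp c * (fact (N + 2) / c ^ (N + 2) * inverse (real (Suc j) ^ (N + 2))) * real (Suc j) ^ N"
      using e by (intro mult_right_mono mult_left_mono) auto
    also have "\<dots> = exp c * (fact (N + 2) / c ^ (N + 2)) * inverse (real (Suc j) ^ 2)"
      by (simp add: power_add power2_eq_square field_simps del: of_nat_Suc)
    finally show "norm (a j) \<le> exp c * (fact (N + 2) / c ^ (N + 2)) * inverse (real (Suc j) ^ 2)"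
      by (simp add: a_def)
  qed
  define K where "K = V * suminf a"
  have a_nonneg: "a j \<ge> 0" for j by (simp add: a_def)
  have "K \<ge> 0" using V \<open>summable a\<close> a_nonneg by (simp add: K_def suminf_nonneg)
  have bound: "(\<integral>\<^sup>+ \<zeta>. ennreal (exp (- (c * t * (norm (\<zeta>::'a))\<^sup>2))) \<partial>lborel) \<le> ennreal (K * t powr (- real N / 2))"
    if t: "t > 0" for t
  proof -
    define r where "r j = real (Suc j) / sqrt t" for j
    have st: "sqrt t > 0" using t by simp
    have pw: "exp (- (c * t * (norm \<zeta>)\<^sup>2)) \<le> (\<Sum>j. ennreal (exp (- (c * real j))) * indicator (cball 0 (r j)) \<zeta>)"
      for \<zeta> :: 'a
    proof -
      \<comment> \<open>The index of the shell containing \<open>\<zeta>\<close>.\<close>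
      define j where "j = nat \<lfloor>norm \<zeta> * sqrt t\<rfloor>"
      have nn: "norm \<zeta> * sqrt t \<ge> 0" using st by simp
      have j1: "real j \<le> norm \<zeta> * sqrt t" and j2: "norm \<zeta> * sqrt t \<le> real (Suc j)"
        unfolding j_def using nn by linarith+
      have mem: "\<zeta> \<in> cball 0 (r j)"
        using j2 st by (simp add: r_def field_simps)
      have "real j \<le> (real j)\<^sup>2" by (cases j) (auto simp: power2_eq_square)
      also have "\<dots> \<le> (norm \<zeta> * sqrt t)\<^sup>2" using j1 by (intro power_mono) auto
      also have "\<dots> = t * (norm \<zeta>)\<^sup>2" using t by (simp add: power_mult_distrib)
      finally have "c * real j \<le> c * (t * (norm \<zeta>)\<^sup>2)" using c by (intro mult_left_mono) auto
      then have "ennreal (exp (- (c * t * (norm \<zeta>)\<^sup>2))) \<le> ennreal (exp (- (c * real j))) * indicator (cball 0 (r j)) \<zeta>"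
        using mem by (auto intro!: ennreal_leI simp: mult.assoc)
      also have "\<dots> = (\<Sum>i\<in>{j}. ennreal (exp (- (c * real i))) * indicator (cball 0 (r i)) \<zeta>)" by (subst sum.insert) auto
      also have "\<dots> \<le> (\<Sum>j. ennreal (exp (- (c * real j))) * indicator (cball 0 (r j)) \<zeta>)"
        by (rule sum_le_suminf) auto
      finally show ?thesis .
    qed
    have "(\<integral>\<^sup>+ \<zeta>. ennreal (exp (- (c * t * (norm (\<zeta>::'a))\<^sup>2))) \<partial>lborel)
        \<le> (\<integral>\<^sup>+ \<zeta>. (\<Sum>j. ennreal (exp (- (c * real j))) * indicator (cball 0 (r j)) (\<zeta>::'a)) \<partial>lborel)"
      by (intro nn_integral_mono pw)
    also have "\<dots> = (\<Sum>j. \<integral>\<^sup>+ \<zeta>. ennreal (exp (- (c * real j))) * indicator (cball 0 (r j)) (\<zeta>::'a) \<partial>lborel)"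
      by (rule nn_integral_suminf) (intro borel_measurable_times_ennreal borel_measurable_const
          borel_measurable_indicator; simp)
    also have "\<dots> = (\<Sum>j. ennreal (V * t powr (- real N / 2) * a j))"
    proof (rule suminf_cong)
      fix j
      have "(\<integral>\<^sup>+ \<zeta>. ennreal (exp (- (c * real j))) * indicator (cball 0 (r j)) (\<zeta>::'a) \<partial>lborel)
        = ennreal (exp (- (c * real j))) * emeasure lborel (cball (0::'a) (r j))"
        by (rule nn_integral_cmult_indicator) simp
      also have "\<dots> = ennreal (exp (- (c * real j))) * ennreal (V * r j ^ N)"
        using st by (subst emeasure_cball) (auto simp: r_def V_def N_def)
      also have "\<dots> = ennreal (exp (- (c * real j)) * (V * r j ^ N))"
        using V st by (intro ennreal_mult[symmetric]) (auto simp: r_def)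
      also have "r j ^ N = real (Suc j) ^ N * t powr (- real N / 2)"
      proof -
        have "sqrt t ^ N = sqrt t powr real N" using st by (simp only: powr_realpow)
        also have "\<dots> = (t powr (1 / 2)) powr real N" using t by (simp only: powr_half_sqrt)
        also have "\<dots> = t powr (real N / 2)" unfolding powr_powr by simp
        finally have "r j ^ N = real (Suc j) ^ N / t powr (real N / 2)"
          unfolding r_def power_divide by (rule arg_cong)
        then show ?thesis
          unfolding minus_divide_left[symmetric] powr_minus_divide by simp
      qed
      finally show "(\<integral>\<^sup>+ \<zeta>. ennreal (exp (- (c * real j))) * indicator (cball 0 (r j)) (\<zeta>::'a) \<partial>lborel)
        = ennreal (V * t powr (- real N / 2) * a j)" by (simp add: a_def mult_ac)
    qed
    also have "\<dots> = ennreal (\<Sum>j. V * t powr (- real N / 2) * a j)"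
      using V \<open>summable a\<close> a_nonneg by (intro suminf_ennreal2 summable_mult) auto
    also have "(\<Sum>j. V * t powr (- real N / 2) * a j) = K * t powr (- real N / 2)"
      using \<open>summable a\<close> by (simp add: suminf_mult K_def)
    finally show ?thesis .
  qed
  show ?thesis
  proof (rule that[OF \<open>K \<ge> 0\<close>])
    fix t :: real assume t: "t > 0"
    show "integrable lborel (\<lambda>\<zeta>::'a. exp (- (c * t * (norm \<zeta>)\<^sup>2)))"
    proof (rule integrableI_nonneg)
      show "(\<integral>\<^sup>+ \<zeta>. ennreal (exp (- (c * t * (norm (\<zeta>::'a))\<^sup>2))) \<partial>lborel) < \<infinity>"
        using bound[OF t] by (rule le_less_trans) simp
    qed auto
    show "(LINT \<zeta>|lborel. exp (- (c * t * (norm (\<zeta>::'a))\<^sup>2))) \<le> K * t powr (- real DIM('a) / 2)"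
      using bound[OF t] \<open>K \<ge> 0\<close> unfolding N_def by (intro integral_real_bounded) auto
  qed
qed

context dispersal
begin

text \<open>Fubini: convolution commutes with a superposition of functions.  It is applied both to
  superpositions of plane waves and to superpositions of translates.\<close>

lemma disperse_integral:
  fixes \<Phi> :: "'b::euclidean_space \<Rightarrow> real ^ 'n \<Rightarrow> real"
  assumes G: "integrable lborel G"
    and [measurable]: "case_prod \<Phi> \<in> borel_measurable (borel \<Otimes>\<^sub>M borel)"
    and le: "\<And>q x. \<bar>\<Phi> q x\<bar> \<le> G q"
  shows "disperse (\<lambda>x. LINT q|lborel. \<Phi> q x) x = (LINT q|lborel. disperse (\<Phi> q) x)"
proof -
  have [measurable]: "G \<in> borel_measurable borel" using G by auto
  have Jx: "integrable lborel (\<lambda>y. J (x - y))"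
    by (intro lborel_integrable_reflect J_integrable)
  have "integrable lborel (\<lambda>(q, y). G q * J (x - y))"
    by (rule lborel_product_integral[OF G Jx])
  then have "integrable (lborel \<Otimes>\<^sub>M lborel) (\<lambda>(q, y). G q * J (x - y))"
    by (simp add: lborel_prod)
  then have int: "integrable (lborel \<Otimes>\<^sub>M lborel) (\<lambda>(q, y). J (x - y) * \<Phi> q y)"
  proof (rule Bochner_Integration.integrable_bound)
    show "AE p in lborel \<Otimes>\<^sub>M lborel. norm (case p of (q, y) \<Rightarrow> J (x - y) * \<Phi> q y)
        \<le> norm (case p of (q, y) \<Rightarrow> G q * J (x - y))"
    proof (intro AE_I2, clarsimp simp: abs_mult J_nonneg)
      fix q y
      have "\<bar>\<Phi> q y\<bar> \<le> \<bar>G q\<bar>" using le[of q y] by linarith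
      then show "J (x - y) * \<bar>\<Phi> q y\<bar> \<le> \<bar>G q\<bar> * J (x - y)"
        by (subst mult.commute) (intro mult_right_mono J_nonneg)
    qed
  qed measurable
  have "disperse (\<lambda>x. LINT q|lborel. \<Phi> q x) x = (LINT y|lborel. (LINT q|lborel. J (x - y) * \<Phi> q y))"
    by (subst disperse_lborel) auto
  also have "\<dots> = (LINT q|lborel. (LINT y|lborel. J (x - y) * \<Phi> q y))"
    using int by (rule lborel_pair.Fubini_integral)
  also have "\<dots> = (LINT q|lborel. disperse (\<Phi> q) x)"
    by (intro Bochner_Integration.integral_cong refl disperse_lborel[symmetric]) simp
  finally show ?thesis .
qed

lemma disperse_translate:
  assumes [measurable]: "f \<in> borel_measurable borel"
  shows "disperse (\<lambda>x. f (x - a)) x = disperse f (x - a)"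
  by (simp add: disperse_convolution algebra_simps)

text \<open>The Fourier transform of the kernel; it is real because the kernel is even.\<close>

definition fourier :: "real ^ 'n \<Rightarrow> real" where
  "fourier \<zeta> = (LINT z|lborel. J z * cos (\<zeta> \<bullet> z))"

lemma fourier_measurable [measurable]: "fourier \<in> borel_measurable borel"
  unfolding fourier_def by measurable

lemma J_times_bounded_integrable:
  assumes "g \<in> borel_measurable borel" "\<And>z. \<bar>g z\<bar> \<le> 1"
  shows "integrable lborel (\<lambda>z. J z * g z)"
proof (rule Bochner_Integration.integrable_bound[OF J_integrable])
  show "(\<lambda>z. J z * g z) \<in> borel_measurable lborel" using assms(1) by simp
  show "AE z in lborel. norm (J z * g z) \<le> norm (J z)"
    using assms(2) by (auto simp: abs_mult J_nonneg mult_left_le)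
qed

lemma fourier_sine_zero: "(LINT z|lborel. J z * sin (\<zeta> \<bullet> z)) = 0"
proof -
  have "(LINT z|lborel. J z * sin (\<zeta> \<bullet> z)) = (LINT z|lborel. J (0 - z) * sin (\<zeta> \<bullet> (0 - z)))"
    by (rule lborel_integral_reflect[symmetric]) measurable
  also have "\<dots> = - (LINT z|lborel. J z * sin (\<zeta> \<bullet> z))"
    by (simp add: J_even)
  finally show ?thesis by simp
qed

text \<open>Plane waves are eigenfunctions of translation-invariant operators; evenness of the kernel removes
  the sine term in the addition theorem.\<close>

lemma disperse_cos: "disperse (\<lambda>y. cos (\<zeta> \<bullet> y)) x = fourier \<zeta> * cos (\<zeta> \<bullet> x)"
proof -
  have "disperse (\<lambda>y. cos (\<zeta> \<bullet> y)) x = (LINT z|lborel. J z * cos (\<zeta> \<bullet> (x - z)))"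
    by (rule disperse_convolution) measurable
  also have "\<dots> = (LINT z|lborel. cos (\<zeta> \<bullet> x) * (J z * cos (\<zeta> \<bullet> z)) + sin (\<zeta> \<bullet> x) * (J z * sin (\<zeta> \<bullet> z)))"
    by (simp add: inner_diff_right cos_diff algebra_simps)
  also have "\<dots> = cos (\<zeta> \<bullet> x) * (LINT z|lborel. J z * cos (\<zeta> \<bullet> z)) + sin (\<zeta> \<bullet> x) * (LINT z|lborel. J z * sin (\<zeta> \<bullet> z))"
    by (subst Bochner_Integration.integral_add) (auto intro!: integrable_mult_right J_times_bounded_integrable)
  finally show ?thesis by (simp add: fourier_sine_zero fourier_def)
qed

lemma fourier_lower_bound:
  assumes "norm \<zeta> * radius \<le> 1"
  shows "fourier \<zeta> \<ge> 1 / 2"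
proof -
  have "1 / 2 = (LINT z|lborel. J z * (1 / 2))" using J_integral by simp
  also have "\<dots> \<le> fourier \<zeta>" unfolding fourier_def
  proof (rule integral_mono)
    show "integrable lborel (\<lambda>z. J z * cos (\<zeta> \<bullet> z))"
      by (intro J_times_bounded_integrable) auto
    fix z
    show "J z * (1 / 2) \<le> J z * cos (\<zeta> \<bullet> z)"
    proof (cases "J z = 0")
      case False
      then have "norm \<zeta> * norm z \<le> norm \<zeta> * radius"
        by (intro mult_left_mono radius) auto
      then have "\<bar>\<zeta> \<bullet> z\<bar> \<le> 1" using Cauchy_Schwarz_ineq2[of \<zeta> z] assms by linarith
      then have "(\<zeta> \<bullet> z)\<^sup>2 \<le> 1" by (simp add: abs_square_le_1)
      then show ?thesis using cos_lower_bound[of "\<zeta> \<bullet> z"] by (intro mult_left_mono J_nonneg) simp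
    qed simp
  qed (use J_integrable in auto)
  finally show ?thesis .
qed

lemma fourier_le_1: "fourier \<zeta> \<le> 1"
proof -
  have "fourier \<zeta> \<le> (LINT z|lborel. J z)" unfolding fourier_def
    by (intro integral_mono J_times_bounded_integrable J_integrable)
      (auto simp: J_nonneg mult_left_le)
  then show ?thesis using J_integral by simp
qed

text \<open>The defect \<open>1 - fourier \<zeta>\<close> is the integral of \<open>J z (1 - cos (\<zeta> \<bullet> z))\<close>, which is at
  least of order \<open>(\<zeta> \<bullet> z)\<^sup>2\<close> on the support.  The kernel is bounded below on some ball about a point \<open>y0\<close>.
  Moving from \<open>y0\<close> by half the radius in the direction of \<open>\<zeta>\<close> or \<open>-\<zeta>\<close>, whichever increases
  \<open>\<bar>\<zeta> \<bullet> y0\<bar>\<close>, leads to a smaller ball on which \<open>\<bar>\<zeta> \<bullet> z\<bar>\<close> is at least of order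
  \<open>norm \<zeta>\<close>, and whose volume does not depend on \<open>\<zeta>\<close>.\<close>

lemma fourier_upper_bound:
  obtains c where "c > 0" "\<And>\<zeta>. norm \<zeta> * radius \<le> 1 \<Longrightarrow> fourier \<zeta> \<le> 1 - c * (norm \<zeta>)\<^sup>2"
proof -
  obtain y0 where y0: "J y0 > 0"
  proof (rule ccontr)
    assume "\<not> thesis"
    then have "J y = 0" for y using that J_nonneg[of y] by (metis less_eq_real_def)
    then show False using J_integral by simp
  qed
  have "isCont J y0" using continuous_J by (simp add: continuous_on_eq_continuous_at)
  then obtain r where r: "r > 0" "\<And>y. dist y y0 < r \<Longrightarrow> dist (J y) (J y0) < J y0 / 2"
    using y0 unfolding continuous_at_eps_delta by (metis half_gt_zero)
  define \<delta> where "\<delta> = J y0 / 2"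
  have \<delta>: "\<delta> > 0" using y0 by (simp add: \<delta>_def)
  have J_ge: "J y \<ge> \<delta>" if "dist y y0 < r" for y
    using r(2)[OF that] unfolding \<delta>_def dist_real_def by linarith
  define v where "v = measure lborel (ball (0::real^'n) (r/4))"
  have v: "v > 0" using r(1) unfolding v_def by (subst content_ball) auto
  define c where "c = \<delta> * v * r\<^sup>2 / 128"
  show ?thesis
  proof (rule that)
    show "c > 0" using \<delta> v r by (simp add: c_def)
    fix \<zeta> :: "real ^ 'n" assume \<zeta>: "norm \<zeta> * radius \<le> 1"
    show "fourier \<zeta> \<le> 1 - c * (norm \<zeta>)\<^sup>2"
    proof (cases "\<zeta> = 0")
      case True then show ?thesis using fourier_le_1 by simp
    next
      case False
      \<comment> \<open>The direction in which the modulus of the phase grows.\<close>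
      define \<sigma> where "\<sigma> = (if \<zeta> \<bullet> y0 \<ge> 0 then 1 else - 1 :: real)"
      define m where "m = y0 + (\<sigma> * r / (2 * norm \<zeta>)) *\<^sub>R \<zeta>"
      have inner_m: "\<bar>\<zeta> \<bullet> m\<bar> \<ge> norm \<zeta> * r / 2"
      proof -
        have "\<zeta> \<bullet> m = \<zeta> \<bullet> y0 + \<sigma> * (norm \<zeta> * r / 2)"
          using False by (simp add: m_def inner_add_right power2_norm_eq_inner[symmetric] power2_eq_square)
        moreover have "norm \<zeta> * r / 2 \<ge> 0" using r by simp
        ultimately show ?thesis by (auto simp: \<sigma>_def)
      qed
      have dist_m: "dist m y0 = r / 2"
        using False r by (simp add: m_def dist_norm \<sigma>_def)
      define p where "p = \<delta> * (norm \<zeta> * r / 4)\<^sup>2 / 8"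
      have p: "p \<ge> 0" using \<delta> by (simp add: p_def)
      have pw: "p * indicator (ball m (r/4)) z \<le> J z * (1 - cos (\<zeta> \<bullet> z))" for z
      proof (cases "z \<in> ball m (r/4)")
        case True
        then have zm: "dist m z < r / 4" by simp
        have "dist z y0 < r"
          using zm dist_m dist_triangle[of z y0 m] r by (simp add: dist_commute)
        then have Jz: "J z \<ge> \<delta>" by (rule J_ge)
        have "J z \<noteq> 0" using Jz \<delta> by linarith
        then have "norm \<zeta> * norm z \<le> norm \<zeta> * radius"
          by (intro mult_left_mono radius) auto
        then have le1: "\<bar>\<zeta> \<bullet> z\<bar> \<le> 1" using Cauchy_Schwarz_ineq2[of \<zeta> z] \<zeta> by linarith
        have "\<bar>\<zeta> \<bullet> (m - z)\<bar> \<le> norm \<zeta> * (r / 4)"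
          using Cauchy_Schwarz_ineq2[of \<zeta> "m - z"] zm
          by (smt (verit, best) dist_norm mult_left_mono norm_ge_zero)
        then have "\<bar>\<zeta> \<bullet> z\<bar> \<ge> norm \<zeta> * r / 4"
          using inner_m unfolding inner_diff_right by linarith
        then have "(norm \<zeta> * r / 4)\<^sup>2 \<le> \<bar>\<zeta> \<bullet> z\<bar>\<^sup>2" using r by (intro power_mono) auto
        then have "(norm \<zeta> * r / 4)\<^sup>2 / 8 \<le> 1 - cos (\<zeta> \<bullet> z)"
          using cos_upper_bound[OF le1] by simp
        then have "\<delta> * ((norm \<zeta> * r / 4)\<^sup>2 / 8) \<le> J z * (1 - cos (\<zeta> \<bullet> z))"
          using Jz \<delta> by (intro mult_mono) auto
        then show ?thesis using True by (simp add: p_def)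
      qed (simp add: J_nonneg)
      have int: "integrable lborel (\<lambda>z. J z * cos (\<zeta> \<bullet> z))"
        by (intro J_times_bounded_integrable) auto
      have fin: "emeasure lborel (ball m (r/4)) < \<infinity>"
        by (rule emeasure_lborel_ball_finite)
      have "measure lborel (ball m (r/4)) = v"
        unfolding v_def using r(1) by (simp add: content_ball)
      then have "p * v = (LINT z|lborel. p * indicator (ball m (r/4)) z)"
        by simp
      also have "\<dots> \<le> (LINT z|lborel. J z * (1 - cos (\<zeta> \<bullet> z)))"
      proof (rule integral_mono)
        show "integrable lborel (\<lambda>z. p * indicator (ball m (r/4)) z)"
          using fin by (intro integrable_mult_right integrable_real_indicator) auto
        show "integrable lborel (\<lambda>z. J z * (1 - cos (\<zeta> \<bullet> z)))"
          using int J_integrable by (simp add: right_diff_distrib)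
      qed (rule pw)
      also have "\<dots> = 1 - fourier \<zeta>"
        using int J_integrable by (simp add: right_diff_distrib J_integral fourier_def)
      finally have "p * v \<le> 1 - fourier \<zeta>" .
      moreover have "p * v = c * (norm \<zeta>)\<^sup>2"
        by (simp add: p_def c_def power_mult_distrib power_divide)
      ultimately show ?thesis by simp
    qed
  qed
qed

end

section \<open>A Fejer-type majorant and the smoothing estimate\<close>

context dispersal
begin

text \<open>The radius is small enough that differences of two frequencies satisfy
  \<open>norm (\<xi> - \<eta>) * radius \<le> 1\<close>, which is the range of the bounds for the Fourier transform.\<close>

definition frequencies :: "(real ^ 'n) set" where
  "frequencies = ball 0 (1 / (2 * radius))"

definition frequency_weight :: "nat \<Rightarrow> (real ^ 'n) \<times> (real ^ 'n) \<Rightarrow> real" where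
  "frequency_weight k q = indicator frequencies (fst q) * indicator frequencies (snd q)
     * fourier (fst q - snd q) ^ k"

text \<open>For \<open>k = 0\<close> this is the squared modulus of the integral of \<open>e\<^bsup>i\<xi>z\<^esup>\<close> over the frequencies,
  written as a double integral of plane waves.  For larger \<open>k\<close> it is the \<open>k\<close>-fold convolution of that
  function with the kernel (\<open>disperse_fejer\<close>).\<close>

definition fejer :: "nat \<Rightarrow> real ^ 'n \<Rightarrow> real" where
  "fejer k z = (LINT q|lborel. frequency_weight k q * cos ((fst q - snd q) \<bullet> z))"

lemma frequencies_measurable [measurable]: "frequencies \<in> sets borel"
  by (simp add: frequencies_def)

lemma frequencies_finite: "emeasure lborel frequencies < \<infinity>"
  unfolding frequencies_def by (rule emeasure_lborel_ball_finite)

lemma frequencies_pos: "measure lborel frequencies > 0"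
  unfolding frequencies_def using radius(1) by (subst content_ball) auto

lemma frequencies_bound: "\<xi> \<in> frequencies \<Longrightarrow> norm \<xi> * radius \<le> 1 / 2"
  using radius(1) by (auto simp: frequencies_def field_simps)

lemma frequencies_diff_bound:
  assumes "\<xi> \<in> frequencies" "\<eta> \<in> frequencies"
  shows "norm (\<xi> - \<eta>) * radius \<le> 1"
proof -
  have "norm (\<xi> - \<eta>) * radius \<le> (norm \<xi> + norm \<eta>) * radius"
    using radius(1) by (intro mult_right_mono norm_triangle_ineq4) auto
  then show ?thesis
    using frequencies_bound[OF assms(1)] frequencies_bound[OF assms(2)] by (simp add: distrib_right)
qed

lemma frequency_weight_measurable [measurable]:
  "frequency_weight k \<in> borel_measurable borel"
proof -
  have "frequency_weight k \<in> borel_measurable (borel \<Otimes>\<^sub>M borel)"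
    unfolding frequency_weight_def by measurable
  then show ?thesis by (simp add: borel_prod)
qed

lemma frequency_weight_bounds:
  "0 \<le> frequency_weight k q"
  "frequency_weight k q \<le> indicator frequencies (fst q) * indicator frequencies (snd q)"
proof -
  have "0 \<le> fourier (fst q - snd q) ^ k \<and> fourier (fst q - snd q) ^ k \<le> 1"
    if "fst q \<in> frequencies" "snd q \<in> frequencies"
  proof -
    have "fourier (fst q - snd q) \<ge> 1/2"
      using that by (intro fourier_lower_bound frequencies_diff_bound)
    then show ?thesis using fourier_le_1 by (auto intro: power_le_one)
  qed
  then show "0 \<le> frequency_weight k q"
    "frequency_weight k q \<le> indicator frequencies (fst q) * indicator frequencies (snd q)"
    by (auto simp: frequency_weight_def indicator_def)
qed

lemma integrable_indicator_frequencies: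
  "integrable lborel (indicator frequencies :: real ^ 'n \<Rightarrow> real)"
  using frequencies_finite by (intro integrable_real_indicator) auto

lemma frequency_weight_integrable: "integrable lborel (frequency_weight k)"
proof (rule Bochner_Integration.integrable_bound)
  show "integrable lborel (\<lambda>(\<xi>, \<eta>). (indicator frequencies \<xi> * indicator frequencies \<eta> :: real))"
    by (intro lborel_product_integral integrable_indicator_frequencies)
  show "AE q in lborel. norm (frequency_weight k q)
      \<le> norm (case q of (\<xi>, \<eta>) \<Rightarrow> (indicator frequencies \<xi> * indicator frequencies \<eta> :: real))"
    using frequency_weight_bounds[of k] by (auto simp: case_prod_unfold)
qed measurable

lemma weighted_cos_measurable [measurable]:
  "(\<lambda>(q, x). frequency_weight k q * cos ((fst q - snd q) \<bullet> x)) \<in> borel_measurable (borel \<Otimes>\<^sub>M borel)"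
proof -
  have "(\<lambda>(q, x). cos ((fst q - snd q) \<bullet> x)) \<in> borel_measurable
     ((borel :: ((real^'n) \<times> (real^'n)) measure) \<Otimes>\<^sub>M (borel :: (real^'n) measure))"
    unfolding borel_prod case_prod_unfold
    by (intro borel_measurable_continuous_onI continuous_intros)
  then show ?thesis unfolding case_prod_unfold by measurable
qed

lemma fejer_measurable [measurable]: "fejer k \<in> borel_measurable borel"
proof -
  have "(\<lambda>(x, q). frequency_weight k q * cos ((fst q - snd q) \<bullet> x)) \<in> borel_measurable
     ((borel :: (real^'n) measure) \<Otimes>\<^sub>M (borel :: ((real^'n) \<times> (real^'n)) measure))"
    using measurable_compose[OF measurable_pair_swap' weighted_cos_measurable[of k]]
    by (simp add: case_prod_unfold)
  then show ?thesis unfolding fejer_def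
    by (intro lborel.borel_measurable_lebesgue_integral) (simp add: case_prod_unfold)
qed

lemma disperse_fejer: "disperse (fejer k) x = fejer (Suc k) x"
proof -
  have "disperse (fejer k) x
      = (LINT q|lborel. disperse (\<lambda>x. frequency_weight k q * cos ((fst q - snd q) \<bullet> x)) x)"
    unfolding fejer_def
  proof (rule disperse_integral[OF frequency_weight_integrable[of k]])
    show "\<bar>frequency_weight k q * cos ((fst q - snd q) \<bullet> x)\<bar> \<le> frequency_weight k q" for q x
      using frequency_weight_bounds(1)[of k q] by (simp add: abs_mult mult_left_le)
  qed measurable
  also have "\<dots> = fejer (Suc k) x"
    unfolding fejer_def
    by (intro Bochner_Integration.integral_cong refl)
      (simp add: disperse_cmult disperse_cos frequency_weight_def)
  finally show ?thesis .
qed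

lemma fejer_bound: "\<bar>fejer k z\<bar> \<le> (LINT q|lborel. frequency_weight k q)"
proof -
  have "\<bar>fejer k z\<bar> \<le> (LINT q|lborel. \<bar>frequency_weight k q * cos ((fst q - snd q) \<bullet> z)\<bar>)"
    unfolding fejer_def using integral_norm_bound[of lborel "\<lambda>q. frequency_weight k q * cos ((fst q - snd q) \<bullet> z)"]
    by simp
  also have "\<dots> \<le> (LINT q|lborel. frequency_weight k q)"
    by (intro integral_mono' frequency_weight_integrable)
      (auto simp: abs_mult frequency_weight_bounds mult_left_le)
  finally show ?thesis .
qed

text \<open>Sum of squares representation, from \<open>cos (a - b) = cos a cos b + sin a sin b\<close>; in particular
  the function is nonnegative everywhere.\<close>

lemma fejer_0:
  "fejer 0 z = (LINT \<xi>|lborel. indicator frequencies \<xi> * cos (\<xi> \<bullet> z))\<^sup>2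
     + (LINT \<xi>|lborel. indicator frequencies \<xi> * sin (\<xi> \<bullet> z))\<^sup>2"
proof -
  have ic: "integrable lborel (\<lambda>\<xi>. indicator frequencies \<xi> * cos (\<xi> \<bullet> z))"
    and is': "integrable lborel (\<lambda>\<xi>. indicator frequencies \<xi> * sin (\<xi> \<bullet> z))"
    by (rule Bochner_Integration.integrable_bound[OF integrable_indicator_frequencies];
        auto simp: abs_mult indicator_def)+
  have "fejer 0 z = (LINT q|lborel.
      (case q of (\<xi>, \<eta>) \<Rightarrow> (indicator frequencies \<xi> * cos (\<xi> \<bullet> z)) * (indicator frequencies \<eta> * cos (\<eta> \<bullet> z)))
    + (case q of (\<xi>, \<eta>) \<Rightarrow> (indicator frequencies \<xi> * sin (\<xi> \<bullet> z)) * (indicator frequencies \<eta> * sin (\<eta> \<bullet> z))))"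
    unfolding fejer_def frequency_weight_def
    by (intro Bochner_Integration.integral_cong refl)
      (auto simp: inner_diff_left cos_diff algebra_simps)
  also have "\<dots> = (LINT \<xi>|lborel. indicator frequencies \<xi> * cos (\<xi> \<bullet> z))\<^sup>2
     + (LINT \<xi>|lborel. indicator frequencies \<xi> * sin (\<xi> \<bullet> z))\<^sup>2"
    by (subst Bochner_Integration.integral_add)
      (use lborel_product_integral[OF ic ic] lborel_product_integral[OF is' is']
        in \<open>auto simp: power2_eq_square\<close>)
  finally show ?thesis .
qed

text \<open>On the support of the kernel all phases \<open>\<xi> \<bullet> z\<close> are at most \<open>1/2\<close>, so the cosine integral there is
  at least half the volume of the frequency ball.  Off the support nonnegativity suffices.\<close>

lemma J_le_fejer: obtains C where "C \<ge> 0" "\<And>z. J z \<le> C * fejer 0 z"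
proof -
  define v where "v = measure lborel frequencies"
  have v: "v > 0" unfolding v_def by (rule frequencies_pos)
  obtain B where B: "B > 0" "\<And>x. J x \<le> B" using J_bounded by blast
  define C where "C = B / (v / 2)\<^sup>2"
  have C: "C \<ge> 0" using B v by (simp add: C_def)
  show ?thesis
  proof (rule that[OF C])
    fix z
    show "J z \<le> C * fejer 0 z"
    proof (cases "J z = 0")
      case True
      then show ?thesis using C by (simp add: fejer_0)
    next
      case False
      then have z: "norm z \<le> radius" by (rule radius)
      have "v / 2 = (LINT \<xi>|lborel. indicator frequencies \<xi> * (1 / 2))" by (simp add: v_def)
      also have "\<dots> \<le> (LINT \<xi>|lborel. indicator frequencies \<xi> * cos (\<xi> \<bullet> z))"
      proof (rule integral_mono)
        show "integrable lborel (\<lambda>\<xi>. indicator frequencies \<xi> * cos (\<xi> \<bullet> z))"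
          by (rule Bochner_Integration.integrable_bound[OF integrable_indicator_frequencies];
              auto simp: abs_mult indicator_def)
        show "integrable lborel (\<lambda>\<xi>. indicator frequencies \<xi> * (1 / 2 :: real))"
          by (intro integrable_mult_left) (simp add: integrable_indicator_frequencies)
        fix \<xi>
        show "indicator frequencies \<xi> * (1 / 2) \<le> indicator frequencies \<xi> * cos (\<xi> \<bullet> z)"
        proof (cases "\<xi> \<in> frequencies")
          case True
          have "\<bar>\<xi> \<bullet> z\<bar> \<le> norm \<xi> * norm z" by (rule Cauchy_Schwarz_ineq2)
          also have "\<dots> \<le> norm \<xi> * radius" using z by (intro mult_left_mono) auto
          also have "\<dots> \<le> 1 / 2" by (rule frequencies_bound[OF True])
          finally have "(\<xi> \<bullet> z)\<^sup>2 \<le> 1" by (simp add: abs_square_le_1)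
          then show ?thesis using True cos_lower_bound[of "\<xi> \<bullet> z"] by simp
        qed simp
      qed
      finally have "(v / 2)\<^sup>2 \<le> (LINT \<xi>|lborel. indicator frequencies \<xi> * cos (\<xi> \<bullet> z))\<^sup>2"
        using v by (intro power_mono) auto
      then have "(v / 2)\<^sup>2 \<le> fejer 0 z"
        unfolding fejer_0 using zero_le_power2 by (rule add_increasing2[rotated])
      then have "C * (v / 2)\<^sup>2 \<le> C * fejer 0 z" using C by (intro mult_left_mono)
      moreover have "C * (v / 2)\<^sup>2 = B" using v by (simp add: C_def)
      ultimately show ?thesis using B(2)[of z] by simp
    qed
  qed
qed

text \<open>Under the integral, the factor \<open>1/2 \<le> fourier\<close> turns \<open>t\<^bsup>k+1\<^esup> fourier\<^sup>k\<close> into at most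
  \<open>2 (t fourier)\<^bsup>k+1\<^esup>\<close>, so the sum is bounded by \<open>2 exp (t fourier)\<close>.  The quadratic upper bound for
  the Fourier transform leaves \<open>exp t\<close> times a Gaussian in \<open>\<xi> - \<eta>\<close>, and integrating over \<open>\<xi>\<close> for
  fixed \<open>\<eta>\<close> gives the decay.\<close>

lemma frequency_weight_exponential_sum:
  obtains K where "K \<ge> 0" "\<And>t n. t > 0 \<Longrightarrow>
    (\<Sum>k<n. t ^ Suc k / fact (Suc k) * (LINT q|lborel. frequency_weight k q))
      \<le> K * exp t * t powr (- real CARD('n) / 2)"
proof -
  obtain c where c: "c > 0"
    and upper: "\<And>\<zeta>. norm \<zeta> * radius \<le> 1 \<Longrightarrow> fourier \<zeta> \<le> 1 - c * (norm \<zeta>)\<^sup>2"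
    by (rule fourier_upper_bound) blast
  obtain K where K: "K \<ge> 0"
    and Kint: "\<And>t. t > 0 \<Longrightarrow> integrable lborel (\<lambda>\<zeta>::real^'n. exp (- (c * t * (norm \<zeta>)\<^sup>2)))"
    and Kle: "\<And>t. t > 0 \<Longrightarrow> (LINT \<zeta>|lborel. exp (- (c * t * (norm (\<zeta>::real^'n))\<^sup>2)))
        \<le> K * t powr (- real DIM(real^'n) / 2)"
    by (rule gaussian_integral_decay[OF c]) blast
  define v where "v = measure lborel frequencies"
  have v: "v > 0" unfolding v_def by (rule frequencies_pos)
  show ?thesis
  proof (rule that[of "2 * v * K"])
    show "2 * v * K \<ge> 0" using v K by simp
    fix t :: real and n :: nat assume t: "t > 0"
    define g where "g \<zeta> = exp (- (c * t * (norm \<zeta>)\<^sup>2))" for \<zeta> :: "real ^ 'n"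
    have g_meas [measurable]: "g \<in> borel_measurable borel"
      unfolding g_def by (intro borel_measurable_continuous_onI continuous_intros)
    have g_int: "integrable lborel g" using Kint[OF t] by (simp add: g_def[abs_def])
    \<comment> \<open>The Gaussian in the difference of the frequencies; dropping the indicator of the first one leaves a full-space integral.\<close>
    define H where "H q = indicator frequencies (snd q) * g (fst q - snd q)"
      for q :: "(real ^ 'n) \<times> (real ^ 'n)"
    have shift: "(LINT \<xi>|lborel. g (\<xi> - \<eta>)) = (LINT \<zeta>|lborel. g \<zeta>)"
      "integrable lborel (\<lambda>\<xi>. g (\<xi> - \<eta>))" for \<eta>
    proof -
      have "g (\<eta> - \<xi>) = g (\<xi> - \<eta>)" for \<xi> by (simp add: g_def norm_minus_commute)
      then show "(LINT \<xi>|lborel. g (\<xi> - \<eta>)) = (LINT \<zeta>|lborel. g \<zeta>)"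
        "integrable lborel (\<lambda>\<xi>. g (\<xi> - \<eta>))"
        using lborel_integral_reflect[OF g_meas, of \<eta>] lborel_integrable_reflect[OF g_int, of \<eta>] by simp_all
    qed
    have H_int: "integrable (lborel \<Otimes>\<^sub>M lborel) (\<lambda>(\<eta>, \<xi>). indicator frequencies \<eta> * g (\<xi> - \<eta>))"
    proof (rule lborel_pair.Fubini_integrable)
      show "integrable lborel (\<lambda>\<eta>. LINT \<xi>|lborel. norm (case (\<eta>, \<xi>) of (\<eta>, \<xi>) \<Rightarrow> indicator frequencies \<eta> * g (\<xi> - \<eta>)))"
        using integrable_indicator_frequencies by (simp add: abs_mult g_def[symmetric] shift abs_of_nonneg[of "g _"])
          (simp add: g_def shift[unfolded g_def])
      show "AE \<eta> in lborel. integrable lborel (\<lambda>\<xi>. case (\<eta>, \<xi>) of (\<eta>, \<xi>) \<Rightarrow> indicator frequencies \<eta> * g (\<xi> - \<eta>))"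
        by (simp add: shift)
    qed measurable
    have H_int': "integrable lborel H"
      using lborel_pair.integrable_product_swap[OF H_int]
      by (simp add: H_def[abs_def] case_prod_unfold lborel_prod)
    have H_val: "(LINT q|lborel. H q) = v * (LINT \<zeta>|lborel. g \<zeta>)"
    proof -
      have "(LINT q|lborel. H q) = integral\<^sup>L (lborel \<Otimes>\<^sub>M lborel) (\<lambda>(\<eta>, \<xi>). indicator frequencies \<eta> * g (\<xi> - \<eta>))"
        using lborel_pair.integral_product_swap[of "\<lambda>(\<eta>, \<xi>). indicator frequencies \<eta> * g (\<xi> - \<eta>)"] H_int
        by (simp add: H_def[abs_def] case_prod_unfold lborel_prod)
      also have "\<dots> = (LINT \<eta>|lborel. indicator frequencies \<eta> * (LINT \<zeta>|lborel. g \<zeta>))"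
        by (subst lborel_pair.integral_fst[OF H_int, symmetric]) (simp add: shift)
      finally show ?thesis by (simp add: v_def)
    qed
    have "(\<Sum>k<n. t ^ Suc k / fact (Suc k) * (LINT q|lborel. frequency_weight k q))
        = (LINT q|lborel. (\<Sum>k<n. t ^ Suc k / fact (Suc k) * frequency_weight k q))"
      by (subst Bochner_Integration.integral_sum)
        (auto intro!: integrable_mult_right frequency_weight_integrable simp del: times_divide_eq_left fact_Suc power_Suc)
    also have "\<dots> \<le> (LINT q|lborel. 2 * exp t * H q)"
    proof (rule integral_mono)
      show "integrable lborel (\<lambda>q. \<Sum>k<n. t ^ Suc k / fact (Suc k) * frequency_weight k q)"
        by (intro Bochner_Integration.integrable_sum integrable_mult_right frequency_weight_integrable)
      show "integrable lborel (\<lambda>q. 2 * exp t * H q)"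
        using H_int' by simp
      fix q :: "(real ^ 'n) \<times> (real ^ 'n)"
      show "(\<Sum>k<n. t ^ Suc k / fact (Suc k) * frequency_weight k q) \<le> 2 * exp t * H q"
      proof (cases "fst q \<in> frequencies \<and> snd q \<in> frequencies")
        case False
        then have "frequency_weight k q = 0" for k by (auto simp: frequency_weight_def)
        then show ?thesis by (simp add: H_def g_def)
      next
        case True
        define F where "F = fourier (fst q - snd q)"
        have nb: "norm (fst q - snd q) * radius \<le> 1" using True by (intro frequencies_diff_bound) auto
        have F: "F \<ge> 1/2" "F \<le> 1 - c * (norm (fst q - snd q))\<^sup>2"
          unfolding F_def using fourier_lower_bound[OF nb] upper[OF nb] by auto
        \<comment> \<open>The exponential series in \<open>t * F\<close>, after inserting the factor \<open>2 * F \<ge> 1\<close>.\<close>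
        have "(\<Sum>k<n. t ^ Suc k / fact (Suc k) * frequency_weight k q) = (\<Sum>k<n. t ^ Suc k / fact (Suc k) * F ^ k)"
          using True by (simp add: frequency_weight_def F_def)
        also have "\<dots> \<le> (\<Sum>k<n. 2 * ((t * F) ^ Suc k / fact (Suc k)))"
        proof (rule sum_mono)
          fix k
          have "t ^ Suc k / fact (Suc k) * F ^ k * 1 \<le> t ^ Suc k / fact (Suc k) * F ^ k * (2 * F)"
            using F t by (intro mult_left_mono) auto
          also have "\<dots> = 2 * ((t * F) ^ Suc k / fact (Suc k))"
            by (simp add: power_mult_distrib mult_ac)
          finally show "t ^ Suc k / fact (Suc k) * F ^ k \<le> 2 * ((t * F) ^ Suc k / fact (Suc k))" by simp
        qed
        also have "\<dots> = 2 * (\<Sum>k<n. (t * F) ^ Suc k / fact (Suc k))" by (rule sum_distrib_left[symmetric])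
        also have "\<dots> \<le> 2 * exp (t * F)"
          using F t by (intro mult_left_mono sum_exp_le_exp_Suc) auto
        also have "\<dots> \<le> 2 * exp (t + - (c * t * (norm (fst q - snd q))\<^sup>2))"
          using mult_left_mono[OF F(2), of t] t by (simp add: algebra_simps)
        also have "\<dots> = 2 * exp t * H q"
          unfolding exp_add using True by (simp add: H_def g_def)
        finally show ?thesis .
      qed
    qed
    also have "\<dots> = 2 * exp t * v * (LINT \<zeta>|lborel. g \<zeta>)" using H_val by simp
    also have "\<dots> \<le> 2 * exp t * v * (K * t powr (- real CARD('n) / 2))"
      using Kle[OF t] v by (intro mult_left_mono) (auto simp: g_def)
    finally show "(\<Sum>k<n. t ^ Suc k / fact (Suc k) * (LINT q|lborel. frequency_weight k q))
      \<le> 2 * v * K * exp t * t powr (- real CARD('n) / 2)" by (simp add: mult_ac)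
  qed
qed

text \<open>The smoothing estimate for the datum \<open>c + f\<close>, in the form of majorants \<open>h\<close> for the iterated
  Duhamel formula.  The datum itself survives only in the term without convolution, hence the summand
  \<open>f x\<close> without a factor \<open>exp t\<close>.  Every further term contains at least one convolution, the first of which
  is estimated by the Fejer-type majorant of the kernel.\<close>

lemma dispersal_smoothing:
  obtains C where "C \<ge> 0"
    "\<And>f c. f \<in> borel_measurable borel \<Longrightarrow> integrable lborel f \<Longrightarrow> bounded_measurable f \<Longrightarrow>
       (\<And>x. f x \<ge> 0) \<Longrightarrow> c \<ge> 0 \<Longrightarrow>
       \<exists>h. h 0 = (\<lambda>x. c + f x) \<and> (\<forall>k. bounded_measurable (h k)) \<and>
         (\<forall>k x. disperse (h k) x \<le> h (Suc k) x) \<and>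
         (\<forall>t>0. \<forall>n x. (\<Sum>k<n. t ^ k / fact k * h k x)
            \<le> f x + exp t * (c + C * (LINT y|lborel. f y) * t powr (- real CARD('n) / 2)))"
proof -
  obtain A where A: "A \<ge> 0" "\<And>z. J z \<le> A * fejer 0 z" using J_le_fejer by blast
  obtain K where K: "K \<ge> 0" "\<And>t n. t > 0 \<Longrightarrow>
    (\<Sum>k<n. t ^ Suc k / fact (Suc k) * (LINT q|lborel. frequency_weight k q))
      \<le> K * exp t * t powr (- real CARD('n) / 2)"
    by (rule frequency_weight_exponential_sum) blast
  show ?thesis
  proof (rule that[of "A * K"])
    show "A * K \<ge> 0" using A K by simp
    fix f :: "real ^ 'n \<Rightarrow> real" and c :: real
    assume f_meas [measurable]: "f \<in> borel_measurable borel" and f_int: "integrable lborel f"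
      and f_bm: "bounded_measurable f" and f_nonneg: "\<And>x. f x \<ge> 0" and c: "c \<ge> 0"
    define m where "m k = (LINT q|lborel. frequency_weight k q)" for k
    \<comment> \<open>Up to the constant from \<open>J_le_fejer\<close>, a bound for \<open>k + 1\<close> convolutions of \<open>f\<close>.\<close>
    define W where "W k x = (LINT y|lborel. f y * fejer k (x - y))" for k x
    have W_meas [measurable]: "W k \<in> borel_measurable borel" for k
      unfolding W_def by measurable
    have fW_int: "integrable lborel (\<lambda>y. f y * fejer k (x - y))" for k x
    proof (rule Bochner_Integration.integrable_bound)
      show "integrable lborel (\<lambda>y. f y * m k)" using f_int by simp
      have "f y * \<bar>fejer k (x - y)\<bar> \<le> f y * \<bar>m k\<bar>" for y
        using fejer_bound[of k "x - y"] unfolding m_def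
        by (intro mult_left_mono f_nonneg) (meson abs_ge_self order_trans)
      then show "AE y in lborel. norm (f y * fejer k (x - y)) \<le> norm (f y * m k)"
        by (simp add: abs_mult f_nonneg)
    qed measurable
    have W_bound: "\<bar>W k x\<bar> \<le> (LINT y|lborel. f y) * m k" for k x
    proof -
      have "\<bar>W k x\<bar> \<le> (LINT y|lborel. \<bar>f y * fejer k (x - y)\<bar>)"
        unfolding W_def using integral_norm_bound[of lborel "\<lambda>y. f y * fejer k (x - y)"] by simp
      also have "\<dots> \<le> (LINT y|lborel. f y * m k)"
        using f_int fejer_bound[of k] unfolding m_def
        by (intro integral_mono integrable_abs fW_int)
          (auto simp: abs_mult f_nonneg intro!: mult_left_mono)
      finally show ?thesis by simp
    qed
    have W_bm: "bounded_measurable (W k)" for k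
      by (rule bounded_measurableI[OF measurable_completion W_bound]) simp
    have W_step: "disperse (W k) x = W (Suc k) x" for k x
    proof -
      have "disperse (W k) x = (LINT y|lborel. disperse (\<lambda>x. f y * fejer k (x - y)) x)"
        unfolding W_def
      proof (rule disperse_integral)
        show "integrable lborel (\<lambda>y. f y * m k)" using f_int by simp
        show "\<bar>f y * fejer k (x - y)\<bar> \<le> f y * m k" for y x
          using fejer_bound[of k "x - y"] unfolding m_def
          by (auto simp: abs_mult f_nonneg intro!: mult_left_mono)
      qed measurable
      then show ?thesis
        by (simp add: disperse_cmult disperse_translate disperse_fejer W_def)
    qed
    define h where "h k = (case k of 0 \<Rightarrow> (\<lambda>x. c + f x) | Suc j \<Rightarrow> (\<lambda>x. c + A * W j x))" for k
    have "h 0 = (\<lambda>x. c + f x)" by (simp add: h_def)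
    moreover have "bounded_measurable (h k)" for k
      unfolding h_def by (cases k)
        (auto intro!: bounded_measurable_add bounded_measurable_cmult bounded_measurable_const f_bm W_bm)
    moreover have "disperse (h k) x \<le> h (Suc k) x" for k x
    proof (cases k)
      case 0
      have "disperse (h k) x = c + disperse f x"
        by (simp add: 0 h_def disperse_add bounded_measurable_const f_bm disperse_const)
      also have "disperse f x \<le> (LINT y|lborel. A * (f y * fejer 0 (x - y)))"
        unfolding disperse_lborel[OF f_meas]
      proof (rule integral_mono)
        show "integrable lborel (\<lambda>y. J (x - y) * f y)"
          using disperse_integrable[OF f_bm, of x] by (simp add: integrable_completion)
        show "integrable lborel (\<lambda>y. A * (f y * fejer 0 (x - y)))"
          using fW_int by simp
        show "J (x - y) * f y \<le> A * (f y * fejer 0 (x - y))" for y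
          using mult_right_mono[OF A(2)[of "x - y"] f_nonneg[of y]] by (simp add: mult_ac)
      qed
      finally show ?thesis by (simp add: 0 h_def W_def)
    next
      case (Suc j)
      then show ?thesis
        by (simp add: h_def disperse_add disperse_cmult disperse_const W_step
            bounded_measurable_const bounded_measurable_cmult W_bm)
    qed
    moreover have "(\<Sum>k<n. t ^ k / fact k * h k x)
            \<le> f x + exp t * (c + A * K * (LINT y|lborel. f y) * t powr (- real CARD('n) / 2))"
      if t: "t > 0" for t n x
    proof -
      have If: "(LINT y|lborel. f y) \<ge> 0" by (simp add: f_nonneg)
      \<comment> \<open>Bounds for \<open>h k - c\<close> that are uniform in space for positive \<open>k\<close>.\<close>
      define d where "d k = (case k of 0 \<Rightarrow> f x | Suc j \<Rightarrow> A * (LINT y|lborel. f y) * m j)" for k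
      have m: "m k \<ge> 0" for k unfolding m_def by (simp add: frequency_weight_bounds)
      have d: "d k \<ge> 0" for k
        unfolding d_def using A(1) If f_nonneg m by (cases k) auto
      have hd: "h k x \<le> c + d k" for k
      proof (cases k)
        case (Suc j)
        have "A * W j x \<le> A * ((LINT y|lborel. f y) * m j)"
          using W_bound[of j x] A(1) by (intro mult_left_mono) auto
        then show ?thesis by (simp add: h_def d_def Suc mult.assoc)
      qed (simp add: h_def d_def)
      have "(\<Sum>k<n. t ^ k / fact k * h k x) \<le> (\<Sum>k<n. t ^ k / fact k * (c + d k))"
        using t by (intro sum_mono mult_left_mono hd) auto
      also have "\<dots> = c * (\<Sum>k<n. t ^ k / fact k) + (\<Sum>k<n. t ^ k / fact k * d k)"
        unfolding distrib_left sum.distrib sum_distrib_left by (simp add: mult.commute)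
      also have "\<dots> \<le> c * exp t + (\<Sum>k<Suc n. t ^ k / fact k * d k)"
        using t c d[of n] by (intro add_mono mult_left_mono sum_exp_le_exp) auto
      also have "(\<Sum>k<Suc n. t ^ k / fact k * d k)
          = f x + A * (LINT y|lborel. f y) * (\<Sum>k<n. t ^ Suc k / fact (Suc k) * m k)"
        unfolding sum.lessThan_Suc_shift sum_distrib_left
        by (simp add: d_def mult_ac del: fact_Suc power_Suc)
      also have "\<dots> \<le> f x + A * (LINT y|lborel. f y) * (K * exp t * t powr (- real CARD('n) / 2))"
        using K(2)[OF t, of n] A(1) If unfolding m_def by (intro add_left_mono mult_left_mono) auto
      finally show ?thesis by (simp add: algebra_simps)
    qed
    ultimately show "\<exists>h. h 0 = (\<lambda>x. c + f x) \<and> (\<forall>k. bounded_measurable (h k)) \<and>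
         (\<forall>k x. disperse (h k) x \<le> h (Suc k) x) \<and>
         (\<forall>t>0. \<forall>n x. (\<Sum>k<n. t ^ k / fact k * h k x)
            \<le> f x + exp t * (c + A * K * (LINT y|lborel. f y) * t powr (- real CARD('n) / 2)))"
      by (intro exI[of _ h]) blast
  qed
qed

end

section \<open>Measurability of time slices\<close>

lemma AE_lborel_interval:
  assumes "AE t in lborel. P t" "a < (b::real)"
  obtains t where "a < t" "t < b" "P t"
proof (rule ccontr)
  assume "\<not> thesis"
  then have neg: "\<forall>t. a < t \<longrightarrow> t < b \<longrightarrow> \<not> P t" using that by blast
  from assms(1) obtain N where N: "{t \<in> space lborel. \<not> P t} \<subseteq> N" "emeasure lborel N = 0" "N \<in> sets lborel"
    by (rule AE_E)
  have "emeasure lborel {a<..<b} \<le> emeasure lborel N"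
    using N neg by (intro emeasure_mono) auto
  then show False using N(2) assms(2) by simp
qed

text \<open>Fubini yields measurability of the slices at almost every time only; continuity in time extends it
  to every time, since each \<open>t\<close> is a limit of good times.\<close>

lemma measurable_time_slices:
  fixes u :: "'a::euclidean_space \<Rightarrow> real \<Rightarrow> real"
  assumes meas: "(\<lambda>(x, t). u x t) \<in> borel_measurable (lebesgue_on (UNIV \<times> {0..}))"
    and cont: "\<And>x. continuous_on {0..} (u x)"
    and t: "t \<ge> 0"
  shows "(\<lambda>x. u x t) \<in> borel_measurable lebesgue"
proof -
  define v where "v q = indicator (UNIV \<times> {0..}) q *\<^sub>R (case q of (x, t) \<Rightarrow> u x t)" for q :: "'a \<times> real"
  have "closed (UNIV \<times> {0::real..} :: ('a \<times> real) set)"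
    by (intro closed_Times) auto
  then have S: "(UNIV \<times> {0::real..} :: ('a \<times> real) set) \<in> sets lebesgue" by auto
  have "v \<in> borel_measurable lebesgue"
    using meas unfolding v_def by (subst (asm) borel_measurable_restrict_space_iff) (use S in auto)
  then obtain g where g: "g \<in> borel_measurable lborel" "AE q in lborel. v q = g q"
    using completion_ex_borel_measurable_real by blast
  from g(2) obtain N where N: "{q \<in> space lborel. \<not> v q = g q} \<subseteq> N" "emeasure lborel N = 0" "N \<in> sets lborel"
    by (rule AE_E)
  have g_meas [measurable]: "g \<in> borel_measurable (borel \<Otimes>\<^sub>M borel)"
    using g(1) by (simp add: borel_prod)
  have N_meas [measurable]: "N \<in> sets (borel \<Otimes>\<^sub>M borel)"
    using N(3) unfolding borel_prod sets_lborel .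
  have "AE q in lborel \<Otimes>\<^sub>M lborel. q \<notin> N"
    using N by (intro AE_I[where N = N]) (auto simp: lborel_prod)
  then have "AE x in lborel. AE t in lborel. (x, t) \<notin> N"
    by (rule lborel_pair.AE_pair)
  then have "AE t in lborel. AE x in lborel. (x, t) \<notin> N"
  proof (subst (asm) lborel_pair.AE_commute)
    have "{q. q \<notin> N} = - N" by auto
    then show "{q \<in> space (lborel \<Otimes>\<^sub>M lborel). (fst q, snd q) \<notin> N} \<in> sets (lborel \<Otimes>\<^sub>M lborel)"
      unfolding lborel_prod using N(3) by (simp add: borel_comp)
  qed
  then have good: "AE t in lborel. t \<ge> 0 \<longrightarrow> (\<lambda>x. u x t) \<in> borel_measurable lebesgue"
  proof (rule AE_mp, intro AE_I2 impI)
    fix t :: real assume AE: "AE x in lborel. (x, t) \<notin> N" and t: "t \<ge> 0"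
    show "(\<lambda>x. u x t) \<in> borel_measurable lebesgue"
    proof (rule borel_measurable_AE)
      show "(\<lambda>x. g (x, t)) \<in> borel_measurable lebesgue"
        by (rule measurable_completion) measurable
      have "AE x in lborel. g (x, t) = u x t"
        using AE
      proof (rule AE_mp, intro AE_I2 impI)
        fix x assume "(x, t) \<notin> N"
        then have "v (x, t) = g (x, t)" using N(1) by auto
        then show "g (x, t) = u x t" using t by (simp add: v_def)
      qed
      then show "AE x in lebesgue. g (x, t) = u x t"
        by (rule AE_completion)
    qed
  qed
  have "\<exists>s. t < s \<and> s < t + inverse (real (Suc n)) \<and> (\<lambda>x. u x s) \<in> borel_measurable lebesgue" for n
    by (rule AE_lborel_interval[OF good, of t "t + inverse (real (Suc n))"]) (use t in auto)
  then obtain s where s: "\<And>n. t < s n" "\<And>n. s n < t + inverse (real (Suc n))"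
    "\<And>n. (\<lambda>x. u x (s n)) \<in> borel_measurable lebesgue"
    by metis
  have "s \<longlonglongrightarrow> t"
  proof (rule tendsto_sandwich[OF _ _ tendsto_const])
    show "(\<lambda>n. t + inverse (real (Suc n))) \<longlonglongrightarrow> t"
      using tendsto_add[OF tendsto_const[of t] LIMSEQ_inverse_real_of_nat] by simp
  qed (use s(1,2) in \<open>auto intro!: always_eventually less_imp_le simp del: of_nat_Suc\<close>)
  then have "(\<lambda>n. u x (s n)) \<longlonglongrightarrow> u x t" for x
    using continuous_on_tendsto_compose[OF cont[of x], of s t sequentially] t s(1)
    by (simp add: always_eventually less_imp_le order_trans)
  then show ?thesis
    by (intro borel_measurable_LIMSEQ_real[OF _ s(3)])
qed

section \<open>Power weights\<close>

definition power_weight :: "real \<Rightarrow> 'a::real_normed_vector \<Rightarrow> real" where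
  "power_weight \<beta> x = (1 + norm x) powr (- \<beta>)"

lemma power_weight_pos: "power_weight \<beta> x > 0"
  using norm_ge_zero[of x] unfolding power_weight_def powr_gt_zero by linarith

lemma power_weight_le_1: "\<beta> \<ge> 0 \<Longrightarrow> power_weight \<beta> x \<le> 1"
  using powr_mono2'[of "-\<beta>" 1 "1 + norm x"] by (simp add: power_weight_def)

lemma power_weight_measurable [measurable]:
  "power_weight \<beta> \<in> borel_measurable (borel :: 'a::euclidean_space measure)"
  unfolding power_weight_def by measurable

lemma bounded_measurable_power_weight:
  assumes "\<beta> \<ge> 0" shows "bounded_measurable (power_weight \<beta>)"
proof (rule bounded_measurableI)
  show "power_weight \<beta> \<in> borel_measurable lebesgue" by (rule measurable_completion) simp
  show "\<bar>power_weight \<beta> x\<bar> \<le> 1" for x :: 'a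
    using power_weight_pos[of \<beta> x] power_weight_le_1[OF assms, of x] by linarith
qed

lemma integrable_indicator_cball:
  "integrable lborel (indicator (cball (0::'a::euclidean_space) r) :: 'a \<Rightarrow> real)"
  by (rule integrable_real_indicator) (use emeasure_lborel_cball_finite in auto)

text \<open>The first argument only carries the type, and thereby the dimension, of the integration variable.\<close>

definition ball_mass :: "'a::euclidean_space itself \<Rightarrow> real \<Rightarrow> nat \<Rightarrow> real" where
  "ball_mass T \<alpha> n = (LINT y|lborel. power_weight \<alpha> (y::'a) * indicator (cball 0 (2 ^ n)) y)"

lemma truncated_weight_integrable:
  assumes "\<alpha> \<ge> 0"
  shows "integrable lborel (\<lambda>y::'a::euclidean_space. power_weight \<alpha> y * indicator (cball 0 r) y)"
proof (rule Bochner_Integration.integrable_bound)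
  show "integrable lborel (indicator (cball 0 r) :: 'a \<Rightarrow> real)"
    by (rule integrable_indicator_cball)
  show "AE y in lborel. norm (power_weight \<alpha> y * indicator (cball 0 r) y) \<le> norm (indicator (cball 0 r) (y::'a) :: real)"
  proof (rule AE_I2)
    fix y :: 'a
    have "\<bar>power_weight \<alpha> y\<bar> \<le> 1"
      using power_weight_pos[of \<alpha> y] power_weight_le_1[OF assms, of y] by linarith
    then show "norm (power_weight \<alpha> y * indicator (cball 0 r) y) \<le> norm (indicator (cball 0 r) y :: real)"
      by (simp add: indicator_def)
  qed
qed (intro borel_measurable_times borel_measurable_indicator; simp)

text \<open>Each dyadic shell contributes its volume times the largest value of the weight on it.\<close>

lemma ball_mass_step:
  assumes "\<alpha> \<ge> 0"
  shows "ball_mass TYPE('a::euclidean_space) \<alpha> (Suc n) \<le> ball_mass TYPE('a) \<alpha> n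
    + unit_ball_vol (real DIM('a)) * 2 ^ DIM('a) * (2 ^ n) powr (real DIM('a) - \<alpha>)"
proof -
  have ind: "integrable lborel (indicator (cball 0 (2 ^ Suc n)) :: 'a \<Rightarrow> real)"
    by (rule integrable_indicator_cball)
  have "ball_mass TYPE('a) \<alpha> (Suc n) \<le> (LINT y|lborel. power_weight \<alpha> (y::'a) * indicator (cball 0 (2 ^ n)) y
      + (2 ^ n) powr (- \<alpha>) * indicator (cball 0 (2 ^ Suc n)) y)"
    unfolding ball_mass_def
  proof (rule integral_mono)
    show "integrable lborel (\<lambda>y::'a. power_weight \<alpha> y * indicator (cball 0 (2 ^ n)) y
      + (2 ^ n) powr (- \<alpha>) * indicator (cball 0 (2 ^ Suc n)) y)"
      by (intro Bochner_Integration.integrable_add truncated_weight_integrable assms integrable_mult_right ind)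
    fix y :: 'a
    show "power_weight \<alpha> y * indicator (cball 0 (2 ^ Suc n)) y \<le> power_weight \<alpha> y * indicator (cball 0 (2 ^ n)) y
      + (2 ^ n) powr (- \<alpha>) * indicator (cball 0 (2 ^ Suc n)) y"
    proof (cases "norm y \<le> 2 ^ n")
      case True
      then show ?thesis using power_weight_pos[of \<alpha> y] by (auto simp: indicator_def)
    next
      case False
      then have "power_weight \<alpha> y \<le> (2 ^ n) powr (- \<alpha>)"
        unfolding power_weight_def using assms by (intro powr_mono2') auto
      then show ?thesis using False by (auto simp: indicator_def)
    qed
  qed (rule truncated_weight_integrable[OF assms])
  also have "\<dots> = ball_mass TYPE('a) \<alpha> n + (2 ^ n) powr (- \<alpha>) * measure lborel (cball (0::'a) (2 ^ Suc n))"
    unfolding ball_mass_def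
    by (subst Bochner_Integration.integral_add)
      (use truncated_weight_integrable[OF assms] ind in auto)
  also have "measure lborel (cball (0::'a) (2 ^ Suc n)) = unit_ball_vol (real DIM('a)) * (2 ^ Suc n) ^ DIM('a)"
    by (rule content_cball) simp
  also have "(2 ^ n) powr (- \<alpha>) * (unit_ball_vol (real DIM('a)) * (2 ^ Suc n) ^ DIM('a))
    = unit_ball_vol (real DIM('a)) * 2 ^ DIM('a) * (2 ^ n) powr (real DIM('a) - \<alpha>)"
  proof -
    have "(2 ^ n) powr (real DIM('a) - \<alpha>) = (2 ^ n) ^ DIM('a) * (2 ^ n) powr (- \<alpha>)"
      by (simp add: powr_realpow[symmetric] powr_add[symmetric])
    then show ?thesis by (simp add: power_mult_distrib)
  qed
  finally show ?thesis .
qed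

lemma ball_mass_0:
  assumes "\<alpha> \<ge> 0"
  shows "ball_mass TYPE('a::euclidean_space) \<alpha> 0 \<le> unit_ball_vol (real DIM('a))"
proof -
  have ind: "integrable lborel (indicator (cball 0 1) :: 'a \<Rightarrow> real)"
    by (rule integrable_indicator_cball)
  have "ball_mass TYPE('a) \<alpha> 0 \<le> (LINT y|lborel. indicator (cball (0::'a) 1) y)"
    unfolding ball_mass_def power_0
    using power_weight_le_1[OF assms] by (intro integral_mono truncated_weight_integrable assms ind)
      (auto simp: indicator_def)
  also have "\<dots> = unit_ball_vol (real DIM('a))"
    using content_cball[of 1 "0::'a"] by simp
  finally show ?thesis .
qed

text \<open>Geometric growth: the constant is chosen so that the contribution of each shell is at most the increment of
  the claimed bound.\<close>

lemma ball_mass_subcritical: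
  assumes "\<alpha> \<ge> 0" "\<alpha> < real DIM('a::euclidean_space)"
  obtains K where "K \<ge> 0" "\<And>n. ball_mass TYPE('a) \<alpha> n \<le> K * (2 ^ n) powr (real DIM('a) - \<alpha>)"
proof -
  define \<gamma> where "\<gamma> = real DIM('a) - \<alpha>"
  have \<gamma>: "\<gamma> > 0" using assms by (simp add: \<gamma>_def)
  define V where "V = unit_ball_vol (real DIM('a))"
  have V: "V > 0" by (simp add: V_def)
  have g2: "2 powr \<gamma> > 1" using \<gamma> by simp
  define K where "K = max V (V * 2 ^ DIM('a) / (2 powr \<gamma> - 1))"
  have K1: "V \<le> K" by (simp add: K_def)
  have "V * 2 ^ DIM('a) / (2 powr \<gamma> - 1) \<le> K" by (simp add: K_def)
  then have K2: "V * 2 ^ DIM('a) \<le> K * (2 powr \<gamma> - 1)"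
    using g2 by (simp add: pos_divide_le_eq)
  have "ball_mass TYPE('a) \<alpha> n \<le> K * (2 ^ n) powr \<gamma>" for n
  proof (induction n)
    case 0
    then show ?case using ball_mass_0[OF assms(1), where 'a = 'a] K1 by (simp add: V_def)
  next
    case (Suc n)
    have "ball_mass TYPE('a) \<alpha> (Suc n) \<le> K * (2 ^ n) powr \<gamma> + V * 2 ^ DIM('a) * (2 ^ n) powr \<gamma>"
      using ball_mass_step[OF assms(1), of n, where 'a = 'a] Suc by (simp add: V_def \<gamma>_def)
    also have "\<dots> \<le> K * (2 ^ n) powr \<gamma> + K * (2 powr \<gamma> - 1) * (2 ^ n) powr \<gamma>"
      using K2 by (intro add_left_mono mult_right_mono) auto
    also have "\<dots> = K * (2 ^ Suc n) powr \<gamma>"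
      by (simp add: powr_mult algebra_simps)
    finally show ?case .
  qed
  then show ?thesis using K1 V by (intro that[of K]) (auto simp: \<gamma>_def)
qed

text \<open>When the exponent equals the dimension all shells contribute comparable amounts, which is the source of the
  logarithm.\<close>

lemma ball_mass_critical:
  "ball_mass TYPE('a::euclidean_space) (real DIM('a)) n
     \<le> unit_ball_vol (real DIM('a)) * (1 + 2 ^ DIM('a) * real n)"
proof (induction n)
  case 0
  then show ?case using ball_mass_0[of "real DIM('a)", where 'a = 'a] by simp
next
  case (Suc n)
  then show ?case
    using ball_mass_step[of "real DIM('a)" n, where 'a = 'a] by (simp add: algebra_simps)
qed

section \<open>Bounds for solutions\<close>

text \<open>The triangle inequality gives \<open>1 + norm x \<le> (1 + R) * (1 + norm y)\<close>.\<close>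

lemma power_weight_comparable:
  assumes "\<beta> \<ge> 0" "R \<ge> 0" "norm (x - y) \<le> R"
  shows "power_weight \<beta> y \<le> (1 + R) powr \<beta> * power_weight \<beta> (x :: 'a::real_normed_vector)"
proof -
  have "norm x \<le> norm y + norm (x - y)" by (rule norm_triangle_sub)
  moreover have "0 \<le> R * norm y" using assms(2) by simp
  ultimately have le: "1 + norm x \<le> (1 + R) * (1 + norm y)"
    using assms(3) by (simp add: algebra_simps)
  have "power_weight \<beta> y = (1 + R) powr \<beta> * ((1 + R) * (1 + norm y)) powr (- \<beta>)"
    using assms(2) by (simp add: power_weight_def powr_mult powr_minus)
  also have "\<dots> \<le> (1 + R) powr \<beta> * (1 + norm x) powr (- \<beta>)"
    using le assms by (intro mult_left_mono powr_mono2') (auto simp: add_pos_nonneg)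
  finally show ?thesis by (simp add: power_weight_def)
qed

context dispersal
begin

lemma disperse_power_weight:
  assumes "\<beta> \<ge> 0"
  shows "disperse (power_weight \<beta>) x \<le> (1 + radius) powr \<beta> * power_weight \<beta> x"
proof -
  have "disperse (power_weight \<beta>) x \<le> disperse (\<lambda>y. (1 + radius) powr \<beta> * power_weight \<beta> x) x"
    using radius(1) power_weight_comparable[OF assms, of radius x]
    by (intro disperse_mono bounded_measurable_power_weight assms bounded_measurable_const) auto
  then show ?thesis by (simp add: disperse_const)
qed

lemma solution_continuous:
  assumes "is_solution J p u0 u"
  shows "continuous_on {0..} (u x)"
proof -
  obtain f' where "\<And>t. t \<ge> 0 \<Longrightarrow> (u x has_real_derivative f' t) (at t within {0..})"
    using assms unfolding is_solution_def C1_on_halfline_def by blast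
  then show ?thesis by (intro DERIV_continuous_on) auto
qed

lemma solution_bounded_measurable:
  assumes sol: "is_solution J p u0 u" and "t \<ge> 0"
  shows "bounded_measurable (\<lambda>x. u x t)"
proof -
  obtain M where "\<And>x t. t \<ge> 0 \<Longrightarrow> u x t \<le> M" "\<And>x t. t \<ge> 0 \<Longrightarrow> u x t \<ge> 0"
    using sol unfolding is_solution_def by blast
  moreover have "(\<lambda>x. u x t) \<in> borel_measurable lebesgue"
    using sol assms(2) solution_continuous[OF sol] unfolding is_solution_def
    by (intro measurable_time_slices) auto
  ultimately show ?thesis
    using assms(2) by (intro bounded_measurableI[where B = M]) auto
qed

lemma solution_derivative:
  assumes sol: "is_solution J p u0 u" and t: "t > 0"
  shows "(u x has_real_derivative disperse (\<lambda>y. u y t) x - u x t - u x t powr p) (at t)"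
proof -
  have "(u x has_real_derivative
      (LINT y|lebesgue. J (x - y) * (u y t - u x t)) - u x t powr p) (at t)"
    using sol t unfolding is_solution_def by blast
  moreover have "(LINT y|lebesgue. J (x - y) * (u y t - u x t)) = disperse (\<lambda>y. u y t - u x t) x"
    by (simp add: disperse_def)
  moreover have "disperse (\<lambda>y. u y t - u x t) x = disperse (\<lambda>y. u y t) x - u x t"
    using t by (subst disperse_diff)
      (auto intro: solution_bounded_measurable[OF sol] bounded_measurable_const simp: disperse_const)
  ultimately show ?thesis by simp
qed

text \<open>The comparison principle applied to \<open>exp t * u\<close>; the absorption term has a favourable sign.\<close>

lemma solution_upper_bound:
  assumes sol: "is_solution J p u0 u"
    and init: "\<And>x. u0 x \<le> h 0 x"
    and h_meas: "\<And>k. bounded_measurable (h k)"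
    and h_step: "\<And>k x. disperse (h k) x \<le> h (Suc k) x"
    and t: "0 \<le> t"
    and E: "\<And>n. (\<Sum>k<n. t ^ k / fact k * h k x) \<le> E"
  shows "exp t * u x t \<le> E"
proof -
  obtain M where M: "\<And>x t. t \<ge> 0 \<Longrightarrow> u x t \<le> M" and nonneg: "\<And>x t. t \<ge> 0 \<Longrightarrow> u x t \<ge> 0"
    and u_init: "\<And>x. u x 0 = u0 x"
    using sol unfolding is_solution_def by blast
  show ?thesis
  proof (rule dispersal_comparison_limit[where V = "\<lambda>x t. exp t * u x t" and T = t
        and M = "exp t * M" and h = h and t = t])
    show "bounded_measurable (\<lambda>x. exp s * u x s)" if "0 \<le> s" for s
      using that by (intro bounded_measurable_cmult solution_bounded_measurable[OF sol])
    show "continuous_on {0..t} (\<lambda>s. exp s * u x s)" for x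
      by (intro continuous_intros continuous_on_subset[OF solution_continuous[OF sol]]) auto
    show "\<exists>D. ((\<lambda>s. exp s * u x s) has_real_derivative D) (at s) \<and> D \<le> disperse (\<lambda>y. exp s * u y s) x"
      if s: "0 < s" for x s
    proof (intro exI conjI)
      show "((\<lambda>s. exp s * u x s) has_real_derivative
          exp s * u x s + (disperse (\<lambda>y. u y s) x - u x s - u x s powr p) * exp s) (at s)"
        by (intro DERIV_mult DERIV_exp solution_derivative[OF sol s])
      have "exp s * (disperse (\<lambda>y. u y s) x - u x s powr p) \<le> exp s * disperse (\<lambda>y. u y s) x"
        by (intro mult_left_mono) auto
      then show "exp s * u x s + (disperse (\<lambda>y. u y s) x - u x s - u x s powr p) * exp s
          \<le> disperse (\<lambda>y. exp s * u y s) x"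
        by (simp add: disperse_cmult algebra_simps)
    qed
    show "exp s * u x s \<le> exp t * M" if "0 \<le> s" "s \<le> t" for x s
      using that M nonneg by (intro mult_mono) auto
  qed (use init u_init h_meas h_step t E in auto)
qed

text \<open>The majorants form a geometric sequence because the weight is an approximate eigenfunction: its
  convolution is at most a multiple of itself.\<close>

lemma solution_weight_bound:
  assumes sol: "is_solution J p u0 u" and "\<alpha> \<ge> 0" "C \<ge> 0" "t \<ge> 0"
    and init: "\<And>x. u0 x \<le> C * power_weight \<alpha> x"
  shows "u x t \<le> C * exp ((1 + radius) powr \<alpha> * t) * power_weight \<alpha> x"
proof -
  define K where "K = (1 + radius) powr \<alpha>"
  have K: "K \<ge> 0" by (simp add: K_def)
  define h where "h k x = K ^ k * C * power_weight \<alpha> x" for k and x :: "real ^ 'n"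
  have "exp t * u x t \<le> C * exp (K * t) * power_weight \<alpha> x"
  proof (rule solution_upper_bound[OF sol, of h])
    show "u0 x \<le> h 0 x" for x using init by (simp add: h_def)
    show "bounded_measurable (h k)" for k
      unfolding h_def by (intro bounded_measurable_cmult bounded_measurable_power_weight assms)
    show "disperse (h k) x \<le> h (Suc k) x" for k x
    proof -
      have "disperse (h k) x = K ^ k * C * disperse (power_weight \<alpha>) x"
        unfolding h_def by (rule disperse_cmult)
      also have "\<dots> \<le> K ^ k * C * (K * power_weight \<alpha> x)"
        using K assms disperse_power_weight[of \<alpha> x] unfolding K_def[symmetric]
        by (intro mult_left_mono) auto
      finally show ?thesis by (simp add: h_def mult_ac)
    qed
    show "t \<ge> 0" by fact
    show "(\<Sum>k<n. t ^ k / fact k * h k x) \<le> C * exp (K * t) * power_weight \<alpha> x" for n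
    proof -
      have "(\<Sum>k<n. t ^ k / fact k * h k x) = C * power_weight \<alpha> x * (\<Sum>k<n. (K * t) ^ k / fact k)"
        unfolding h_def sum_distrib_left by (intro sum.cong refl) (simp add: power_mult_distrib mult_ac)
      also have "\<dots> \<le> C * power_weight \<alpha> x * exp (K * t)"
        using K assms power_weight_pos[of \<alpha> x] by (intro mult_left_mono sum_exp_le_exp) auto
      finally show ?thesis by (simp add: mult_ac)
    qed
  qed
  moreover have "1 * u x t \<le> exp t * u x t"
    using sol assms(4) unfolding is_solution_def by (intro mult_right_mono) auto
  ultimately show ?thesis by (simp add: K_def)
qed

text \<open>The datum is at most a constant plus an integrable function: outside the ball of radius \<open>2 ^ n\<close> it is
  bounded by the value of the weight there, and inside the smoothing estimate applies.\<close>

lemma solution_split_bound: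
  assumes sol: "is_solution J p u0 u" and \<alpha>: "\<alpha> \<ge> 0" and C0: "C0 \<ge> 0"
    and init: "\<And>x. u0 x \<le> C0 * power_weight \<alpha> x"
  obtains C where "C \<ge> 0" "\<And>t x n. t > 0 \<Longrightarrow> u x t \<le> C0 * ((2 ^ n) powr (- \<alpha>) + exp (- t)
    + C * ball_mass TYPE(real ^ 'n) \<alpha> n * t powr (- real CARD('n) / 2))"
proof -
  obtain C where C: "C \<ge> 0" and smoothing:
    "\<And>f c. f \<in> borel_measurable borel \<Longrightarrow> integrable lborel f \<Longrightarrow> bounded_measurable f \<Longrightarrow>
       (\<And>x. f x \<ge> 0) \<Longrightarrow> c \<ge> 0 \<Longrightarrow>
       \<exists>h. h 0 = (\<lambda>x. c + f x) \<and> (\<forall>k. bounded_measurable (h k)) \<and>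
         (\<forall>k x. disperse (h k) x \<le> h (Suc k) x) \<and>
         (\<forall>t>0. \<forall>n x. (\<Sum>k<n. t ^ k / fact k * h k x)
            \<le> f x + exp t * (c + C * (LINT y|lborel. f y) * t powr (- real CARD('n) / 2)))"
    using dispersal_smoothing by blast
  show ?thesis
  proof (rule that[OF C])
    fix t x and n :: nat assume t: "(t::real) > 0"
    define f where "f y = C0 * (power_weight \<alpha> y * indicator (cball 0 (2 ^ n)) y)" for y :: "real ^ 'n"
    define c where "c = C0 * (2 ^ n) powr (- \<alpha>)"
    have f_meas: "f \<in> borel_measurable borel"
      unfolding f_def by (intro borel_measurable_times borel_measurable_const borel_measurable_indicator) auto
    have f_int: "integrable lborel f"
      unfolding f_def by (intro integrable_mult_right truncated_weight_integrable \<alpha>)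
    have f_nonneg: "f y \<ge> 0" for y
      unfolding f_def using C0 power_weight_pos[of \<alpha> y] by (simp add: indicator_def)
    have f_le: "f y \<le> C0" for y
      unfolding f_def using C0 power_weight_le_1[OF \<alpha>, of y] by (auto simp: indicator_def mult_left_le)
    have f_bm: "bounded_measurable f"
      using f_nonneg f_le by (intro bounded_measurableI[where B = C0] measurable_completion) (auto simp: f_meas)
    have c: "c \<ge> 0" using C0 by (simp add: c_def)
    obtain h where h: "h 0 = (\<lambda>x. c + f x)" "\<And>k. bounded_measurable (h k)"
      "\<And>k x. disperse (h k) x \<le> h (Suc k) x"
      "\<And>t n x. t > 0 \<Longrightarrow> (\<Sum>k<n. t ^ k / fact k * h k x)
            \<le> f x + exp t * (c + C * (LINT y|lborel. f y) * t powr (- real CARD('n) / 2))"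
      using smoothing[OF f_meas f_int f_bm f_nonneg c] by blast
    have I: "(LINT y|lborel. f y) = C0 * ball_mass TYPE(real ^ 'n) \<alpha> n"
      unfolding f_def ball_mass_def by simp
    have "exp t * u x t \<le> f x + exp t * (c + C * (LINT y|lborel. f y) * t powr (- real CARD('n) / 2))"
    proof (rule solution_upper_bound[OF sol, of h])
      show "u0 x \<le> h 0 x" for x
      proof (cases "norm x \<le> 2 ^ n")
        case True
        then show ?thesis using init[of x] c by (simp add: h(1) f_def)
      next
        case False
        then have "power_weight \<alpha> x \<le> (2 ^ n) powr (- \<alpha>)"
          unfolding power_weight_def using \<alpha> by (intro powr_mono2') auto
        then have "C0 * power_weight \<alpha> x \<le> c" unfolding c_def using C0 by (intro mult_left_mono)
        then show ?thesis using init[of x] f_nonneg[of x] by (simp add: h(1))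
      qed
    qed (use h t in auto)
    also have "\<dots> \<le> C0 + exp t * (c + C * (LINT y|lborel. f y) * t powr (- real CARD('n) / 2))"
      using f_le by simp
    finally have le: "exp (- t) * (exp t * u x t)
        \<le> exp (- t) * (C0 + exp t * (c + C * (LINT y|lborel. f y) * t powr (- real CARD('n) / 2)))"
      by (intro mult_left_mono) auto
    have cancel: "exp (- t) * (exp t * y) = y" for y
      by (simp add: exp_minus field_simps)
    have "u x t \<le> exp (- t) * C0 + (c + C * (LINT y|lborel. f y) * t powr (- real CARD('n) / 2))"
      using le by (simp only: distrib_left[of "exp (- t)"] cancel)
    then show "u x t \<le> C0 * ((2 ^ n) powr (- \<alpha>) + exp (- t)
        + C * ball_mass TYPE(real ^ 'n) \<alpha> n * t powr (- real CARD('n) / 2))"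
      unfolding I c_def by (simp add: algebra_simps)
  qed
qed

end

text \<open>Raise \<open>t / a \<le> exp (t / a)\<close> to the power \<open>a\<close>.\<close>

lemma exp_minus_le_powr:
  assumes "a > 0" "t > (0::real)"
  shows "exp (- t) \<le> a powr a * t powr (- a)"
proof -
  have "t / a \<le> exp (t / a)" using exp_ge_add_one_self[of "t / a"] by linarith
  then have "a * (t / a) \<le> a * exp (t / a)" using assms by (intro mult_left_mono) auto
  then have "t powr a \<le> (a * exp (t / a)) powr a"
    using assms by (intro powr_mono2) auto
  also have "\<dots> = a powr a * exp t"
    using assms by (simp add: powr_mult exp_powr_real)
  finally show ?thesis
    using assms by (simp add: powr_minus exp_minus field_simps)
qed

lemma dyadic_scale:
  assumes "s \<ge> (1::real)"
  obtains n where "2 ^ n \<le> s" "s < 2 * 2 ^ n" "real n * ln 2 \<le> ln s"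
proof -
  define n where "n = nat \<lfloor>log 2 s\<rfloor>"
  have l: "log 2 s \<ge> 0" using assms by simp
  have n1: "real n \<le> log 2 s" and n2: "log 2 s < real (Suc n)"
    unfolding n_def using l by linarith+
  have s: "2 powr log 2 s = s" using assms by simp
  have "2 powr real n \<le> 2 powr log 2 s" using n1 by simp
  then have "2 ^ n \<le> s" unfolding s by (simp add: powr_realpow)
  moreover have "2 powr log 2 s < 2 powr real (Suc n)" using n2 by simp
  then have "s < 2 * 2 ^ n" unfolding s by (subst (asm) powr_realpow) auto
  moreover have "real n * ln 2 \<le> ln s" using n1 by (simp add: log_def field_simps)
  ultimately show ?thesis by (rule that)
qed

lemma sqrt_powr: "t \<ge> 0 \<Longrightarrow> sqrt t powr a = t powr (a / 2)"
  by (simp add: powr_half_sqrt[symmetric] powr_powr)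

context dispersal
begin

text \<open>The datum is split at a dyadic radius comparable to \<open>sqrt t\<close>, which balances the constant part with the
  smoothed part.  Times up to \<open>1\<close> are covered by boundedness.\<close>

lemma solution_decay_subcritical:
  assumes sol: "is_solution J p u0 u" and \<alpha>: "\<alpha> > 0" "\<alpha> < real CARD('n)" and C0: "C0 \<ge> 0"
    and init: "\<And>x. u0 x \<le> C0 * power_weight \<alpha> x"
  shows "\<exists>C. \<forall>x. \<forall>t>0. u x t \<le> C * t powr (- \<alpha> / 2)"
proof -
  define N where "N = real CARD('n)"
  obtain M where M: "\<And>x t. t \<ge> 0 \<Longrightarrow> u x t \<le> M"
    using sol unfolding is_solution_def by blast
  have \<alpha>0: "\<alpha> \<ge> 0" using \<alpha> by simp
  obtain C where C: "C \<ge> 0" and split: "\<And>t x n. t > 0 \<Longrightarrow> u x t \<le> C0 * ((2 ^ n) powr (- \<alpha>) + exp (- t)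
    + C * ball_mass TYPE(real ^ 'n) \<alpha> n * t powr (- N / 2))"
    unfolding N_def using solution_split_bound[OF sol \<alpha>0 C0 init] by blast
  obtain K where K: "K \<ge> 0" and mass: "\<And>n. ball_mass TYPE(real ^ 'n) \<alpha> n \<le> K * (2 ^ n) powr (N - \<alpha>)"
    using ball_mass_subcritical[OF \<alpha>0, where 'a = "real ^ 'n"] \<alpha>(2) unfolding N_def by auto
  define D where "D = C0 * (2 powr \<alpha> + (\<alpha>/2) powr (\<alpha>/2) + C * K)"
  have "u x t \<le> max \<bar>M\<bar> D * t powr (- \<alpha> / 2)" if t: "t > 0" for x t
  proof (cases "t \<le> 1")
    case True
    then have "1 \<le> t powr (- \<alpha> / 2)" using t \<alpha> powr_mono2'[of "- \<alpha> / 2" t 1] by simp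
    then have "\<bar>M\<bar> * 1 \<le> max \<bar>M\<bar> D * t powr (- \<alpha> / 2)" by (intro mult_mono) auto
    then show ?thesis using M[of t x] t by linarith
  next
    case False
    then obtain n where n: "2 ^ n \<le> sqrt t" "sqrt t < 2 * 2 ^ n"
      using dyadic_scale[of "sqrt t"] by auto
    have "(2 ^ n) powr (- \<alpha>) \<le> (sqrt t / 2) powr (- \<alpha>)"
      using n t \<alpha> by (intro powr_mono2') auto
    also have "\<dots> = 2 powr \<alpha> * t powr (- \<alpha> / 2)"
      using t by (simp add: powr_divide sqrt_powr powr_minus field_simps)
    finally have 1: "(2 ^ n) powr (- \<alpha>) \<le> 2 powr \<alpha> * t powr (- \<alpha> / 2)" .
    have 2: "exp (- t) \<le> (\<alpha>/2) powr (\<alpha>/2) * t powr (- \<alpha> / 2)"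
      using exp_minus_le_powr[of "\<alpha>/2" t] \<alpha> t by simp
    have "C * ball_mass TYPE(real ^ 'n) \<alpha> n * t powr (- N / 2)
        \<le> C * (K * (sqrt t) powr (N - \<alpha>)) * t powr (- N / 2)"
    proof (intro mult_right_mono mult_left_mono)
      have "K * (2 ^ n) powr (N - \<alpha>) \<le> K * (sqrt t) powr (N - \<alpha>)"
        using n K \<alpha> by (intro mult_left_mono powr_mono2) (auto simp: N_def)
      then show "ball_mass TYPE(real ^ 'n) \<alpha> n \<le> K * (sqrt t) powr (N - \<alpha>)"
        using mass[of n] by linarith
    qed (use C in auto)
    also have "\<dots> = C * K * (t powr ((N - \<alpha>) / 2) * t powr (- N / 2))"
      using t by (simp add: sqrt_powr)
    also have "t powr ((N - \<alpha>) / 2) * t powr (- N / 2) = t powr (- \<alpha> / 2)"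
      unfolding powr_add[symmetric] by (simp add: diff_divide_distrib)
    finally have 3: "C * ball_mass TYPE(real ^ 'n) \<alpha> n * t powr (- N / 2) \<le> C * K * t powr (- \<alpha> / 2)" .
    have "u x t \<le> C0 * (2 powr \<alpha> * t powr (- \<alpha> / 2) + (\<alpha>/2) powr (\<alpha>/2) * t powr (- \<alpha> / 2)
        + C * K * t powr (- \<alpha> / 2))"
      using split[OF t, of x n] mult_left_mono[OF add_mono[OF add_mono[OF 1 2] 3] C0] by linarith
    also have "\<dots> = D * t powr (- \<alpha> / 2)" by (simp add: D_def algebra_simps)
    also have "\<dots> \<le> max \<bar>M\<bar> D * t powr (- \<alpha> / 2)" by (intro mult_right_mono) auto
    finally show ?thesis .
  qed
  then show ?thesis by blast
qed

text \<open>As in the subcritical case, but the mass of the truncated weight now grows with the number \<open>n\<close> of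
  dyadic shells, which is of order \<open>ln t\<close>.\<close>

lemma solution_decay_critical:
  assumes sol: "is_solution J p u0 u" and C0: "C0 \<ge> 0"
    and init: "\<And>x. u0 x \<le> C0 * power_weight (real CARD('n)) x"
  shows "\<exists>C. \<forall>x. \<forall>t\<ge>2. u x t \<le> C * t powr (- real CARD('n) / 2) * ln t"
proof -
  define N where "N = real CARD('n)"
  have N: "N > 0" by (simp add: N_def)
  obtain C where C: "C \<ge> 0" and split: "\<And>t x n. t > 0 \<Longrightarrow> u x t \<le> C0 * ((2 ^ n) powr (- N) + exp (- t)
    + C * ball_mass TYPE(real ^ 'n) N n * t powr (- N / 2))"
    unfolding N_def using solution_split_bound[OF sol _ C0 init] by auto
  define V where "V = unit_ball_vol N"
  have V: "V \<ge> 0" using N by (simp add: V_def)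
  have mass: "ball_mass TYPE(real ^ 'n) N n \<le> V * (1 + 2 powr N * real n)" for n
    using ball_mass_critical[where 'a = "real ^ 'n", of n] by (simp add: V_def N_def powr_realpow)
  define D where "D = C0 * (2 powr N + (N/2) powr (N/2) + C * (V * (1 + 2 powr N))) / ln 2"
  have "u x t \<le> D * t powr (- N / 2) * ln t" if t2: "t \<ge> 2" for x t
  proof -
    have t: "t > 0" using t2 by simp
    \<comment> \<open>At least \<open>1\<close> for \<open>t \<ge> 2\<close>, so that the terms without a logarithm are absorbed.\<close>
    define L where "L = ln t / ln 2"
    have L: "L \<ge> 1" using t2 by (simp add: L_def)
    have grow: "a \<le> a * L" if "a \<ge> 0" for a
      using mult_left_mono[OF L that] by simp
    obtain n where n: "2 ^ n \<le> sqrt t" "sqrt t < 2 * 2 ^ n" "real n * ln 2 \<le> ln (sqrt t)"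
      using dyadic_scale[of "sqrt t"] t2 by auto
    have "real n * ln 2 \<le> ln t"
      using n(3) t2 ln_ge_zero[of t] ln_sqrt[of t] by linarith
    then have nL: "real n \<le> L" by (simp add: L_def field_simps)
    have "(2 ^ n) powr (- N) \<le> (sqrt t / 2) powr (- N)"
      using n t N by (intro powr_mono2') auto
    also have "\<dots> = 2 powr N * t powr (- N / 2)"
      using t by (simp add: powr_divide sqrt_powr powr_minus field_simps)
    also have "\<dots> \<le> 2 powr N * t powr (- N / 2) * L"
      by (rule grow) simp
    finally have 1: "(2 ^ n) powr (- N) \<le> 2 powr N * t powr (- N / 2) * L" .
    have "exp (- t) \<le> (N/2) powr (N/2) * t powr (- N / 2)"
      using exp_minus_le_powr[of "N/2" t] N t by simp
    also have "\<dots> \<le> (N/2) powr (N/2) * t powr (- N / 2) * L"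
      by (rule grow) simp
    finally have 2: "exp (- t) \<le> (N/2) powr (N/2) * t powr (- N / 2) * L" .
    have "ball_mass TYPE(real ^ 'n) N n \<le> V * (1 * L + 2 powr N * L)"
    proof -
      have "V * (1 + 2 powr N * real n) \<le> V * (1 * L + 2 powr N * L)"
        using V L nL by (intro mult_left_mono add_mono) auto
      then show ?thesis using mass[of n] by linarith
    qed
    then have 3: "C * ball_mass TYPE(real ^ 'n) N n * t powr (- N / 2) \<le> C * (V * (1 * L + 2 powr N * L)) * t powr (- N / 2)"
      using C by (intro mult_right_mono mult_left_mono) auto
    have "u x t \<le> C0 * (2 powr N * t powr (- N / 2) * L + (N/2) powr (N/2) * t powr (- N / 2) * L
        + C * (V * (1 * L + 2 powr N * L)) * t powr (- N / 2))"
      using split[OF t, of x n] mult_left_mono[OF add_mono[OF add_mono[OF 1 2] 3] C0] by linarith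
    also have "\<dots> = C0 * (2 powr N + (N/2) powr (N/2) + C * (V * (1 + 2 powr N))) * t powr (- N / 2) * L"
      by (simp add: algebra_simps)
    also have "\<dots> = D * t powr (- N / 2) * ln t" by (simp add: D_def L_def)
    finally show ?thesis .
  qed
  then show ?thesis unfolding N_def by blast
qed

end

section \<open>Spatial asymptotics\<close>

lemma power_weight_decays:
  assumes "\<beta> > 0"
  shows "((power_weight \<beta> :: 'a::real_normed_vector \<Rightarrow> real) \<longlongrightarrow> 0) at_infinity"
proof -
  have "filterlim (\<lambda>x::'a. 1 + norm x) at_top at_infinity"
    by (rule filterlim_tendsto_add_at_top[OF tendsto_const filterlim_norm_at_top])
  then show ?thesis
    unfolding power_weight_def using assms by (intro tendsto_neg_powr) auto
qed

lemma norm_ratio_tendsto: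
  "((\<lambda>x::'a::real_normed_vector. (a + norm x) / (b + norm x)) \<longlongrightarrow> 1) at_infinity"
proof -
  have top: "filterlim (\<lambda>x::'a. b + norm x) at_top at_infinity"
    by (rule filterlim_tendsto_add_at_top[OF tendsto_const filterlim_norm_at_top])
  have "((\<lambda>x::'a. 1 + (a - b) / (b + norm x)) \<longlongrightarrow> 1 + 0) at_infinity"
    by (intro tendsto_add tendsto_const real_tendsto_divide_at_top[OF tendsto_const top])
  moreover have "eventually (\<lambda>x::'a. 1 + (a - b) / (b + norm x) = (a + norm x) / (b + norm x)) at_infinity"
    using filterlim_at_top_dense[THEN iffD1, OF top, rule_format, of 0]
    by eventually_elim (simp add: field_simps)
  ultimately show ?thesis by (simp add: tendsto_cong)
qed

lemma norm_ratio_powr_tendsto: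
  "((\<lambda>x::'a::real_normed_vector. ((a + norm x) / (b + norm x)) powr \<beta>) \<longlongrightarrow> 1) at_infinity"
  using tendsto_powr[OF norm_ratio_tendsto[of a b] tendsto_const[of \<beta>]] by simp

lemma norm_powr_times_weight:
  "norm x powr \<alpha> * power_weight \<alpha> x = ((0 + norm x) / (1 + norm x)) powr \<alpha>"
  by (simp add: power_weight_def powr_minus_divide powr_divide)

lemma powr_times_power_weight: "(1 + norm x) powr \<beta> * power_weight \<beta> x = 1"
proof -
  have "1 + norm x \<noteq> 0" using norm_ge_zero[of x] by linarith
  then show ?thesis by (simp add: power_weight_def powr_add[symmetric])
qed

lemma eventually_norm_gt: "eventually (\<lambda>x::'a::real_normed_vector. norm x > r) at_infinity"
  using filterlim_at_top_dense[THEN iffD1, OF filterlim_norm_at_top] by blast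

lemma initial_weight_bound:
  fixes u0 :: "'a::real_normed_vector \<Rightarrow> real"
  assumes lim: "((\<lambda>x. norm x powr \<alpha> * u0 x) \<longlongrightarrow> A) at_infinity" and \<alpha>: "\<alpha> > 0"
    and M: "\<And>x. u0 x \<le> M" and nonneg: "\<And>x. u0 x \<ge> 0"
  obtains C where "C \<ge> 0" "\<And>x. u0 x \<le> C * power_weight \<alpha> x"
proof -
  have "eventually (\<lambda>x. norm x powr \<alpha> * u0 x < A + 1) at_infinity"
    using lim by (rule order_tendstoD) simp
  then obtain b where b: "\<And>x. norm x \<ge> b \<Longrightarrow> norm x powr \<alpha> * u0 x < A + 1"
    unfolding eventually_at_infinity by blast
  define r where "r = max b 1"
  define C where "C = max \<bar>2 powr \<alpha> * (A + 1)\<bar> (\<bar>M\<bar> * (1 + r) powr \<alpha>)"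
  have r: "r \<ge> 1" "b \<le> r" by (auto simp: r_def)
  have C: "C \<ge> 0" by (simp add: C_def)
  have "u0 x * (1 + norm x) powr \<alpha> \<le> C" for x
  proof (cases "norm x \<ge> r")
    case True
    have "(1 + norm x) powr \<alpha> \<le> (2 * norm x) powr \<alpha>"
      using True r \<alpha> by (intro powr_mono2) auto
    also have "\<dots> = 2 powr \<alpha> * norm x powr \<alpha>" by (simp add: powr_mult)
    finally have "u0 x * (1 + norm x) powr \<alpha> \<le> u0 x * (2 powr \<alpha> * norm x powr \<alpha>)"
      using nonneg by (intro mult_left_mono)
    also have "\<dots> = 2 powr \<alpha> * (norm x powr \<alpha> * u0 x)" by simp
    also have "\<dots> \<le> 2 powr \<alpha> * (A + 1)"
      using b[of x] True r by (intro mult_left_mono) auto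
    also have "\<dots> \<le> C" by (simp add: C_def le_max_iff_disj abs_ge_self)
    finally show ?thesis .
  next
    case False
    then have "u0 x * (1 + norm x) powr \<alpha> \<le> \<bar>M\<bar> * (1 + r) powr \<alpha>"
      using M[of x] nonneg[of x] \<alpha> by (intro mult_mono powr_mono2) auto
    then show ?thesis by (simp add: C_def)
  qed
  moreover have "u0 x = u0 x * (1 + norm x) powr \<alpha> * power_weight \<alpha> x" for x
    by (simp add: powr_times_power_weight mult.assoc)
  ultimately have "u0 x \<le> C * power_weight \<alpha> x" for x
    using power_weight_pos[of \<alpha> x] by (metis less_imp_le mult_right_mono)
  with C show ?thesis by (rule that)
qed

text \<open>A bounded function that is negligible against one weight at infinity is at most a small multiple of
  that weight, up to a multiple of any other weight that controls it on a ball.\<close>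

lemma negligible_weight_bound:
  fixes f :: "'a::real_normed_vector \<Rightarrow> real"
  assumes lim: "((\<lambda>x. f x / power_weight \<alpha> x) \<longlongrightarrow> 0) at_infinity"
    and B: "\<And>x. \<bar>f x\<bar> \<le> B" and \<beta>: "\<beta> \<ge> 0" and \<epsilon>: "\<epsilon> > 0"
  obtains H where "H \<ge> 0" "\<And>x. \<bar>f x\<bar> \<le> \<epsilon> * power_weight \<alpha> x + H * power_weight \<beta> x"
proof -
  have "eventually (\<lambda>x. \<bar>f x / power_weight \<alpha> x\<bar> < \<epsilon>) at_infinity"
    using tendstoD[OF lim \<epsilon>] by (simp add: dist_real_def)
  then obtain b where b: "\<And>x. norm x \<ge> b \<Longrightarrow> \<bar>f x / power_weight \<alpha> x\<bar> < \<epsilon>"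
    unfolding eventually_at_infinity by blast
  define r where "r = max b 0"
  define H where "H = B * (1 + r) powr \<beta>"
  have B0: "B \<ge> 0" using B[of 0] by linarith
  have H: "H \<ge> 0" using B0 by (simp add: H_def)
  have "\<bar>f x\<bar> \<le> \<epsilon> * power_weight \<alpha> x + H * power_weight \<beta> x" for x
  proof (cases "norm x \<ge> r")
    case True
    then have "\<bar>f x\<bar> \<le> \<epsilon> * power_weight \<alpha> x"
      using b[of x] power_weight_pos[of \<alpha> x] by (simp add: r_def abs_divide pos_divide_less_eq)
    moreover have "H * power_weight \<beta> x \<ge> 0"
      using H power_weight_pos[of \<beta> x] by simp
    ultimately show ?thesis by linarith
  next
    case False
    have "B * 1 \<le> B * ((1 + r) powr \<beta> * power_weight \<beta> x)"
    proof (intro mult_left_mono B0)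
      have "(1 + norm x) powr \<beta> * power_weight \<beta> x = 1"
        by (rule powr_times_power_weight)
      moreover have "(1 + norm x) powr \<beta> * power_weight \<beta> x \<le> (1 + r) powr \<beta> * power_weight \<beta> x"
        using False \<beta> power_weight_pos[of \<beta> x] by (intro mult_right_mono powr_mono2) auto
      ultimately show "1 \<le> (1 + r) powr \<beta> * power_weight \<beta> x" by simp
    qed
    then have "B \<le> H * power_weight \<beta> x" by (simp add: H_def mult.assoc)
    moreover have "\<epsilon> * power_weight \<alpha> x \<ge> 0"
      using \<epsilon> power_weight_pos[of \<alpha> x] by simp
    ultimately show ?thesis using B[of x] by linarith
  qed
  with H show ?thesis by (rule that)
qed

context dispersal
begin

text \<open>By locality the convolution of the weight at \<open>x\<close> lies between the values of the weight at norm
  \<open>norm x + radius\<close> and \<open>norm x - radius\<close>, and both are asymptotic to its value at \<open>x\<close>.\<close>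

lemma disperse_weight_ratio:
  assumes \<alpha>: "\<alpha> > 0"
  shows "((\<lambda>x. disperse (power_weight \<alpha>) x / power_weight \<alpha> x) \<longlongrightarrow> 1) at_infinity"
proof (rule tendsto_sandwich)
  show "((\<lambda>x::real^'n. ((1 + norm x) / ((1 + radius) + norm x)) powr \<alpha>) \<longlongrightarrow> 1) at_infinity"
    "((\<lambda>x::real^'n. ((1 + norm x) / ((1 - radius) + norm x)) powr \<alpha>) \<longlongrightarrow> 1) at_infinity"
    by (rule norm_ratio_powr_tendsto)+
  have bm: "bounded_measurable (power_weight \<alpha> :: real ^ 'n \<Rightarrow> real)"
    using \<alpha> by (intro bounded_measurable_power_weight) simp
  show "\<forall>\<^sub>F x in at_infinity. ((1 + norm x) / ((1 + radius) + norm x)) powr \<alpha>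
      \<le> disperse (power_weight \<alpha>) x / power_weight \<alpha> x"
  proof (intro always_eventually allI)
    fix x :: "real ^ 'n"
    have "disperse (\<lambda>y. (1 + radius + norm x) powr (- \<alpha>)) x \<le> disperse (power_weight \<alpha>) x"
    proof (rule disperse_mono[OF bounded_measurable_const bm])
      fix y assume "norm (x - y) \<le> radius"
      then have "norm y \<le> radius + norm x"
        using norm_triangle_sub[of y x] by (simp add: norm_minus_commute)
      then show "(1 + radius + norm x) powr (- \<alpha>) \<le> power_weight \<alpha> y"
        unfolding power_weight_def using \<alpha> by (intro powr_mono2') (auto simp: add_pos_nonneg)
    qed
    then have "(1 + radius + norm x) powr (- \<alpha>) \<le> disperse (power_weight \<alpha>) x"
      by (simp add: disperse_const)
    then have "(1 + radius + norm x) powr (- \<alpha>) / power_weight \<alpha> x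
        \<le> disperse (power_weight \<alpha>) x / power_weight \<alpha> x"
      using power_weight_pos[of \<alpha> x] by (intro divide_right_mono) auto
    moreover have "(1 + radius + norm x) powr (- \<alpha>) / power_weight \<alpha> x
        = ((1 + norm x) / ((1 + radius) + norm x)) powr \<alpha>"
      using radius(1) by (simp add: power_weight_def powr_divide powr_minus field_simps)
    ultimately show "((1 + norm x) / ((1 + radius) + norm x)) powr \<alpha>
      \<le> disperse (power_weight \<alpha>) x / power_weight \<alpha> x" by simp
  qed
  show "\<forall>\<^sub>F x in at_infinity. disperse (power_weight \<alpha>) x / power_weight \<alpha> x
      \<le> ((1 + norm x) / ((1 - radius) + norm x)) powr \<alpha>"
    using eventually_norm_gt[of radius]
  proof eventually_elim
    case (elim x)
    have "disperse (power_weight \<alpha>) x \<le> disperse (\<lambda>y. (1 - radius + norm x) powr (- \<alpha>)) x"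
    proof (rule disperse_mono[OF bm bounded_measurable_const])
      fix y assume "norm (x - y) \<le> radius"
      then have "norm x \<le> norm y + radius"
        using norm_triangle_sub[of x y] by simp
      then show "power_weight \<alpha> y \<le> (1 - radius + norm x) powr (- \<alpha>)"
        unfolding power_weight_def using \<alpha> elim by (intro powr_mono2') auto
    qed
    then have "disperse (power_weight \<alpha>) x \<le> (1 - radius + norm x) powr (- \<alpha>)"
      by (simp add: disperse_const)
    then have "disperse (power_weight \<alpha>) x / power_weight \<alpha> x
        \<le> (1 - radius + norm x) powr (- \<alpha>) / power_weight \<alpha> x"
      using power_weight_pos[of \<alpha> x] by (intro divide_right_mono) auto
    moreover have "(1 - radius + norm x) powr (- \<alpha>) / power_weight \<alpha> x
        = ((1 + norm x) / ((1 - radius) + norm x)) powr \<alpha>"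
      using elim by (simp add: power_weight_def powr_divide powr_minus field_simps)
    ultimately show ?case by simp
  qed
qed

text \<open>The difference \<open>z = u - A w\<close> satisfies \<open>z\<^sub>t = J * z - z + A (J * w - w) - u\<^sup>p\<close>.  The source and the
  initial value are negligible against \<open>w\<close> at infinity, hence bounded by \<open>h = \<epsilon> w + H w'\<close> with \<open>w'\<close> the
  faster decaying weight.  As \<open>J * h \<le> K h\<close>, the function \<open>exp ((K + 1) t) h\<close> is a supersolution for both
  \<open>exp t * z\<close> and \<open>- exp t * z\<close>.\<close>

lemma solution_near_profile:
  assumes sol: "is_solution J p u0 u" and \<alpha>: "\<alpha> > 0" and A: "A \<ge> 0" and p: "p > 1" and T: "T \<ge> 0"
    and lim: "((\<lambda>x. norm x powr \<alpha> * u0 x) \<longlongrightarrow> A) at_infinity"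
    and C0: "C0 \<ge> 0" and init: "\<And>x. u0 x \<le> C0 * power_weight \<alpha> x"
    and \<epsilon>: "\<epsilon> > 0"
  obtains H where "H \<ge> 0" "\<And>x t. 0 \<le> t \<Longrightarrow> t \<le> T \<Longrightarrow>
    \<bar>u x t - A * power_weight \<alpha> x\<bar>
      \<le> exp (((1 + radius) powr (\<alpha> + 1) + 1) * T) * (\<epsilon> * power_weight \<alpha> x + H * power_weight (\<alpha> + 1) x)"
proof -
  define w where "w = (power_weight \<alpha> :: real ^ 'n \<Rightarrow> real)"
  define w' where "w' = (power_weight (\<alpha> + 1) :: real ^ 'n \<Rightarrow> real)"
  define K where "K = (1 + radius) powr (\<alpha> + 1)"
  have w_pos: "w x > 0" for x unfolding w_def by (rule power_weight_pos)
  have w'_pos: "w' x > 0" for x unfolding w'_def by (rule power_weight_pos)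
  have w_le: "w x \<le> 1" for x unfolding w_def using \<alpha> by (intro power_weight_le_1) simp
  have w_bm: "bounded_measurable w" unfolding w_def using \<alpha> by (intro bounded_measurable_power_weight) simp
  have w'_bm: "bounded_measurable w'" unfolding w'_def using \<alpha> by (intro bounded_measurable_power_weight) simp
  have Lw: "disperse w x \<le> K * w x" for x
  proof -
    have "disperse w x \<le> (1 + radius) powr \<alpha> * w x"
      unfolding w_def using \<alpha> by (intro disperse_power_weight) simp
    also have "\<dots> \<le> K * w x"
      unfolding K_def using radius(1) w_pos[of x] by (intro mult_right_mono powr_mono) auto
    finally show ?thesis .
  qed
  have Lw': "disperse w' x \<le> K * w' x" for x
    unfolding w'_def K_def using \<alpha> by (intro disperse_power_weight) simp
  have Lw_nonneg: "disperse w x \<ge> 0" for x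
    using disperse_mono[OF bounded_measurable_const w_bm, of x 0] w_pos
    by (simp add: disperse_const less_imp_le)
  have K: "K \<ge> 0" by (simp add: K_def)
  obtain M where M: "\<And>x t. t \<ge> 0 \<Longrightarrow> u x t \<le> M" and nonneg: "\<And>x t. t \<ge> 0 \<Longrightarrow> u x t \<ge> 0"
    and u_init: "\<And>x. u x 0 = u0 x"
    using sol unfolding is_solution_def by blast
  define CT where "CT = C0 * exp ((1 + radius) powr \<alpha> * T)"
  have CT: "CT \<ge> 0" using C0 by (simp add: CT_def)
  have u_le: "u x t \<le> CT * w x" if "0 \<le> t" "t \<le> T" for x t
  proof -
    have "u x t \<le> C0 * exp ((1 + radius) powr \<alpha> * t) * w x"
      unfolding w_def using solution_weight_bound[OF sol _ C0 that(1) init] \<alpha> by simp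
    also have "\<dots> \<le> CT * w x"
      unfolding CT_def using that C0 w_pos[of x]
      by (intro mult_right_mono mult_left_mono exp_le_cancel_iff[THEN iffD2]) auto
    finally show ?thesis .
  qed
  \<comment> \<open>A bound for source and initial value at once.\<close>
  define G where "G x = exp T * (A * \<bar>disperse w x - w x\<bar> + (CT * w x) powr p) + \<bar>u0 x - A * w x\<bar>" for x
  have G_bound: "\<bar>G x\<bar> \<le> exp T * (A * (K + 1) + CT powr p) + (C0 + A)" for x
  proof -
    have "disperse w x \<le> K" using Lw[of x] w_le[of x] K w_pos[of x]
      by (smt (verit) mult_left_le)
    then have 1: "\<bar>disperse w x - w x\<bar> \<le> K + 1"
      using Lw_nonneg[of x] w_le[of x] w_pos[of x] K by linarith
    have 2: "(CT * w x) powr p \<le> CT powr p"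
      using CT w_le[of x] w_pos[of x] p by (intro powr_mono2) (auto simp: mult_left_le)
    have "u0 x \<le> C0" using init[of x] w_le[of x] C0 unfolding w_def
      by (smt (verit) mult_left_le)
    moreover have "u0 x \<ge> 0" using nonneg[of 0 x] u_init by simp
    moreover have "0 \<le> A * w x" "A * w x \<le> A" using A w_le[of x] w_pos[of x] by (auto simp: mult_left_le)
    ultimately have 3: "\<bar>u0 x - A * w x\<bar> \<le> C0 + A" using C0 by linarith
    have "G x \<le> exp T * (A * (K + 1) + CT powr p) + (C0 + A)"
      unfolding G_def using 1 2 3 A by (intro add_mono mult_left_mono) auto
    moreover have "G x \<ge> 0" unfolding G_def using A by simp
    ultimately show ?thesis by simp
  qed
  have G_lim: "((\<lambda>x. G x / power_weight \<alpha> x) \<longlongrightarrow> 0) at_infinity"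
  proof -
    have l1: "((\<lambda>x. \<bar>disperse w x / w x - 1\<bar>) \<longlongrightarrow> 0) at_infinity"
      using disperse_weight_ratio[OF \<alpha>] unfolding w_def
      by (intro tendsto_rabs_zero) (simp add: LIM_zero)
    have l2: "((\<lambda>x. CT powr p * power_weight (\<alpha> * (p - 1)) (x::real^'n)) \<longlongrightarrow> CT powr p * 0) at_infinity"
      using \<alpha> p by (intro tendsto_intros power_weight_decays) simp
    have "((\<lambda>x. ((1 + norm x) / (0 + norm x)) powr \<alpha> * (norm x powr \<alpha> * u0 x) - A) \<longlongrightarrow> 1 * A - A) at_infinity"
      by (intro tendsto_intros norm_ratio_powr_tendsto lim)
    moreover have "eventually (\<lambda>x. ((1 + norm x) / (0 + norm x)) powr \<alpha> * (norm x powr \<alpha> * u0 x) - A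
        = (u0 x - A * w x) / w x) at_infinity"
      using eventually_norm_gt[of 0]
    proof eventually_elim
      case (elim x)
      then have "((1 + norm x) / (0 + norm x)) powr \<alpha> * norm x powr \<alpha> = (1 + norm x) powr \<alpha>"
        by (simp add: powr_divide)
      also have "\<dots> = 1 / w x" by (simp add: w_def power_weight_def powr_minus_divide)
      finally have "((1 + norm x) / (0 + norm x)) powr \<alpha> * (norm x powr \<alpha> * u0 x) = u0 x / w x"
        by (simp add: mult.assoc[symmetric])
      then show ?case using w_pos[of x] by (simp add: diff_divide_distrib)
    qed
    ultimately have "((\<lambda>x. (u0 x - A * w x) / w x) \<longlongrightarrow> 0) at_infinity"
      by (simp add: tendsto_cong)
    then have l3: "((\<lambda>x. \<bar>(u0 x - A * w x) / w x\<bar>) \<longlongrightarrow> 0) at_infinity"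
      by (rule tendsto_rabs_zero)
    have "((\<lambda>x. exp T * (A * \<bar>disperse w x / w x - 1\<bar> + CT powr p * power_weight (\<alpha> * (p - 1)) x)
        + \<bar>(u0 x - A * w x) / w x\<bar>) \<longlongrightarrow> exp T * (A * 0 + CT powr p * 0) + 0) at_infinity"
      by (intro tendsto_add tendsto_mult tendsto_const l1 l2 l3)
    moreover have "exp T * (A * \<bar>disperse w x / w x - 1\<bar> + CT powr p * power_weight (\<alpha> * (p - 1)) x)
        + \<bar>(u0 x - A * w x) / w x\<bar> = G x / power_weight \<alpha> x" for x
    proof -
      have a: "\<bar>disperse w x / w x - 1\<bar> = \<bar>disperse w x - w x\<bar> / w x"
      proof -
        have "disperse w x / w x - 1 = (disperse w x - w x) / w x"
          using w_pos[of x] by (simp add: diff_divide_distrib)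
        then show ?thesis using w_pos[of x] by (simp only: abs_divide abs_of_pos)
      qed
      have "power_weight (\<alpha> * (p - 1)) x * w x = w x powr p"
        by (simp add: w_def power_weight_def powr_powr powr_add[symmetric] algebra_simps)
      then have b: "CT powr p * power_weight (\<alpha> * (p - 1)) x = (CT * w x) powr p / w x"
        using w_pos[of x] CT by (simp add: powr_mult field_simps)
      have c: "\<bar>(u0 x - A * w x) / w x\<bar> = \<bar>u0 x - A * w x\<bar> / w x"
        using w_pos[of x] by simp
      show ?thesis unfolding a b c G_def w_def[symmetric] by (simp add: add_divide_distrib distrib_left)
    qed
    ultimately show ?thesis by simp
  qed
  obtain H where H: "H \<ge> 0" and GH: "\<And>x. \<bar>G x\<bar> \<le> \<epsilon> * power_weight \<alpha> x + H * power_weight (\<alpha> + 1) x"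
    using negligible_weight_bound[OF G_lim G_bound, of "\<alpha> + 1" \<epsilon>] \<epsilon> \<alpha> by auto
  define h where "h x = \<epsilon> * w x + H * w' x" for x
  have h_nonneg: "h x \<ge> 0" for x
    unfolding h_def using \<epsilon> H w_pos[of x] w'_pos[of x] by simp
  have h_bm: "bounded_measurable h"
    unfolding h_def by (intro bounded_measurable_add bounded_measurable_cmult w_bm w'_bm)
  have Lh: "disperse h x \<le> K * h x" for x
  proof -
    have "disperse h x = \<epsilon> * disperse w x + H * disperse w' x"
      unfolding h_def by (simp add: disperse_add disperse_cmult bounded_measurable_cmult w_bm w'_bm)
    also have "\<dots> \<le> \<epsilon> * (K * w x) + H * (K * w' x)"
      using \<epsilon> H by (intro add_mono mult_left_mono Lw Lw') auto
    finally show ?thesis by (simp add: h_def algebra_simps)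
  qed
  have source: "exp t * (A * \<bar>disperse w x - w x\<bar> + u x t powr p) \<le> h x"
    and initial: "\<bar>u0 x - A * w x\<bar> \<le> h x" if t: "0 \<le> t" "t \<le> T" for x t
  proof -
    have Gh: "G x \<le> h x" using GH[of x] unfolding h_def w_def w'_def by linarith
    have "u x t powr p \<le> (CT * w x) powr p"
      using u_le[OF t] nonneg t p by (intro powr_mono2) auto
    then have "exp t * (A * \<bar>disperse w x - w x\<bar> + u x t powr p)
        \<le> exp T * (A * \<bar>disperse w x - w x\<bar> + (CT * w x) powr p)"
      using t A by (intro mult_mono add_left_mono) auto
    also have "\<dots> \<le> G x" unfolding G_def by simp
    finally show "exp t * (A * \<bar>disperse w x - w x\<bar> + u x t powr p) \<le> h x" using Gh by simp
    have "\<bar>u0 x - A * w x\<bar> \<le> G x" unfolding G_def using A by simp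
    then show "\<bar>u0 x - A * w x\<bar> \<le> h x" using Gh by simp
  qed
  \<comment> \<open>The sign \<open>\<sigma>\<close> yields the upper and the lower bound at once.\<close>
  have comparison: "\<sigma> * (exp t * (u x t - A * w x)) \<le> exp ((K + 1) * t) * h x"
    if \<sigma>: "\<bar>\<sigma>\<bar> = 1" and t: "0 \<le> t" "t \<le> T" for \<sigma> x t
  proof -
    define V where "V x t = \<sigma> * (exp t * (u x t - A * w x)) - exp ((K + 1) * t) * h x" for x t
    have "V x t \<le> 0"
    proof (rule dispersal_comparison_limit[where T = T and M = "exp T * (\<bar>M\<bar> + A)" and h = "\<lambda>k x. 0" and V = V])
      show "bounded_measurable (\<lambda>x. V x s)" if "0 \<le> s" for s
        unfolding V_def using that
        by (intro bounded_measurable_diff bounded_measurable_cmult solution_bounded_measurable[OF sol] w_bm h_bm)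
      show "continuous_on {0..T} (V x)" for x
        unfolding V_def
        by (intro continuous_intros continuous_on_subset[OF solution_continuous[OF sol]]) auto
      show "\<exists>D. (V x has_real_derivative D) (at s) \<and> D \<le> disperse (\<lambda>y. V y s) x"
        if s: "0 < s" "s < T" for x s
      proof (intro exI conjI)
        let ?D = "\<sigma> * (exp s * (disperse (\<lambda>y. u y s) x - u x s powr p - A * w x))
            - (K + 1) * exp ((K + 1) * s) * h x"
        show "(V x has_real_derivative ?D) (at s)"
          unfolding V_def
          by (rule derivative_eq_intros solution_derivative[OF sol s(1)] refl | simp add: algebra_simps)+
        have u_bm: "bounded_measurable (\<lambda>y. u y s)"
          using s by (intro solution_bounded_measurable[OF sol]) simp
        have "disperse (\<lambda>y. V y s) x
            = \<sigma> * (exp s * (disperse (\<lambda>y. u y s) x - A * disperse w x)) - exp ((K + 1) * s) * disperse h x"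
          unfolding V_def
          by (simp add: disperse_diff disperse_cmult bounded_measurable_diff bounded_measurable_cmult u_bm w_bm h_bm)
        moreover have "?D \<le> \<sigma> * (exp s * (disperse (\<lambda>y. u y s) x - A * disperse w x)) - exp ((K + 1) * s) * disperse h x"
        proof -
          have "\<sigma> * (exp s * (A * (disperse w x - w x) - u x s powr p))
              \<le> \<bar>\<sigma> * (exp s * (A * (disperse w x - w x) - u x s powr p))\<bar>" by (rule abs_ge_self)
          also have "\<dots> = exp s * \<bar>A * (disperse w x - w x) - u x s powr p\<bar>"
            using \<sigma> by (simp add: abs_mult)
          also have "\<dots> \<le> exp s * (A * \<bar>disperse w x - w x\<bar> + u x s powr p)"
          proof (intro mult_left_mono)
            have "\<bar>A * (disperse w x - w x)\<bar> = A * \<bar>disperse w x - w x\<bar>" using A by (simp add: abs_mult)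
            moreover have "u x s powr p \<ge> 0" by simp
            ultimately show "\<bar>A * (disperse w x - w x) - u x s powr p\<bar> \<le> A * \<bar>disperse w x - w x\<bar> + u x s powr p"
              by linarith
          qed simp
          also have "\<dots> \<le> 1 * h x" using source[of s x] s by simp
          also have "\<dots> \<le> exp ((K + 1) * s) * h x"
            using h_nonneg K s by (intro mult_right_mono) auto
          finally have 1: "\<sigma> * (exp s * (A * (disperse w x - w x) - u x s powr p)) \<le> exp ((K + 1) * s) * h x" .
          have 2: "exp ((K + 1) * s) * disperse h x \<le> exp ((K + 1) * s) * (K * h x)"
            by (intro mult_left_mono Lh) simp
          show ?thesis using 1 2 by (simp only: algebra_simps)
        qed
        ultimately show "?D \<le> disperse (\<lambda>y. V y s) x" by simp
      qed
      show "V x s \<le> exp T * (\<bar>M\<bar> + A)" if s: "0 \<le> s" "s \<le> T" for x s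
      proof -
        have "0 \<le> A * w x" "A * w x \<le> A" using A w_le[of x] w_pos[of x] by (auto simp: mult_left_le)
        then have "\<bar>u x s - A * w x\<bar> \<le> \<bar>M\<bar> + A" using M[of s x] nonneg[of s x] s by linarith
        then have "\<bar>\<sigma> * (exp s * (u x s - A * w x))\<bar> \<le> exp T * (\<bar>M\<bar> + A)"
          using \<sigma> s by (simp add: abs_mult) (intro mult_mono, auto)
        moreover have "exp ((K + 1) * s) * h x \<ge> 0" using h_nonneg by simp
        ultimately show ?thesis unfolding V_def by linarith
      qed
      show "V x 0 \<le> 0" for x
      proof -
        have "\<sigma> * (u0 x - A * w x) \<le> \<bar>\<sigma> * (u0 x - A * w x)\<bar>" by (rule abs_ge_self)
        also have "\<dots> \<le> h x" using initial[of 0 x] T \<sigma> by (simp add: abs_mult)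
        finally show ?thesis by (simp add: V_def u_init)
      qed
    qed (use t in \<open>auto simp: disperse_const bounded_measurable_const\<close>)
    then show ?thesis by (simp add: V_def)
  qed
  have final: "\<bar>u x t - A * w x\<bar> \<le> exp ((K + 1) * T) * h x" if t: "0 \<le> t" "t \<le> T" for x t
  proof -
    have "1 * \<bar>u x t - A * w x\<bar> \<le> exp t * \<bar>u x t - A * w x\<bar>"
      using t by (intro mult_right_mono) auto
    also have "\<dots> \<le> exp ((K + 1) * t) * h x"
      using comparison[of 1 t x] comparison[of "-1" t x] t by (cases "u x t \<ge> A * w x") (auto simp: algebra_simps)
    also have "\<dots> \<le> exp ((K + 1) * T) * h x"
      using h_nonneg K t by (intro mult_right_mono) (auto intro: mult_left_mono)
    finally show ?thesis by simp
  qed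
  show ?thesis
    using final by (intro that[OF H]) (simp add: K_def h_def w_def w'_def)
qed

text \<open>After multiplication by \<open>norm x powr \<alpha>\<close>, which is at most the reciprocal of the weight, the error
  \<open>\<epsilon> w + H w'\<close> becomes \<open>\<epsilon> + H / (1 + norm x)\<close>; the factor \<open>E\<close> does not depend on \<open>\<epsilon>\<close>, so \<open>\<epsilon>\<close> can be
  chosen to compensate it.\<close>

lemma solution_asymptotics:
  assumes sol: "is_solution J p u0 u" and \<alpha>: "\<alpha> > 0" and A: "A \<ge> 0" and p: "p > 1" and T: "T \<ge> 0"
    and lim: "((\<lambda>x. norm x powr \<alpha> * u0 x) \<longlongrightarrow> A) at_infinity"
    and C0: "C0 \<ge> 0" and init: "\<And>x. u0 x \<le> C0 * power_weight \<alpha> x"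
  shows "uniform_limit {0..T} (\<lambda>x t. norm x powr \<alpha> * u x t) (\<lambda>t. A) at_infinity"
  unfolding uniform_limit_iff
proof (intro allI impI)
  fix e :: real assume e: "e > 0"
  define E where "E = exp (((1 + radius) powr (\<alpha> + 1) + 1) * T)"
  have E: "E > 0" by (simp add: E_def)
  define \<epsilon> where "\<epsilon> = e / 3 / E"
  have \<epsilon>: "\<epsilon> > 0" using e E by (simp add: \<epsilon>_def)
  obtain H where H: "H \<ge> 0" and near: "\<And>x t. 0 \<le> t \<Longrightarrow> t \<le> T \<Longrightarrow>
    \<bar>u x t - A * power_weight \<alpha> x\<bar> \<le> E * (\<epsilon> * power_weight \<alpha> x + H * power_weight (\<alpha> + 1) x)"
    unfolding E_def using solution_near_profile[OF sol \<alpha> A p T lim C0 init \<epsilon>] by blast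
  have "((\<lambda>x::real^'n. E * H * power_weight 1 x + A * \<bar>((0 + norm x) / (1 + norm x)) powr \<alpha> - 1\<bar>)
      \<longlongrightarrow> E * H * 0 + A * \<bar>1 - 1\<bar>) at_infinity"
    by (intro tendsto_intros power_weight_decays norm_ratio_powr_tendsto) simp
  then have "eventually (\<lambda>x::real^'n. E * H * power_weight 1 x
      + A * \<bar>((0 + norm x) / (1 + norm x)) powr \<alpha> - 1\<bar> < e / 3) at_infinity"
    using e by (intro order_tendstoD) auto
  then show "\<forall>\<^sub>F x in at_infinity. \<forall>t\<in>{0..T}. dist (norm x powr \<alpha> * u x t) A < e"
  proof (rule eventually_mono, intro ballI)
    fix x :: "real ^ 'n" and t
    assume small: "E * H * power_weight 1 x + A * \<bar>((0 + norm x) / (1 + norm x)) powr \<alpha> - 1\<bar> < e / 3"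
      and t: "t \<in> {0..T}"
    define N where "N = norm x powr \<alpha>"
    have N: "N \<ge> 0" by (simp add: N_def)
    have Nw: "N * power_weight \<alpha> x = ((0 + norm x) / (1 + norm x)) powr \<alpha>"
      unfolding N_def by (rule norm_powr_times_weight)
    have Nw1: "N * power_weight \<alpha> x \<le> 1"
      unfolding Nw using \<alpha> powr_mono2[of \<alpha> "(0 + norm x) / (1 + norm x)" 1]
      by (simp add: add_pos_nonneg)
    have w1: "power_weight (\<alpha> + 1) x = power_weight \<alpha> x * power_weight 1 x"
      unfolding power_weight_def powr_add[symmetric] by simp
    have "N * \<bar>u x t - A * power_weight \<alpha> x\<bar> \<le> N * (E * (\<epsilon> * power_weight \<alpha> x + H * power_weight (\<alpha> + 1) x))"
      using near[of t x] t N by (intro mult_left_mono) auto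
    also have "\<dots> = (N * power_weight \<alpha> x) * (E * \<epsilon> + E * H * power_weight 1 x)"
      unfolding w1 by (simp add: algebra_simps)
    also have "\<dots> \<le> 1 * (E * \<epsilon> + E * H * power_weight 1 x)"
      using Nw1 E H \<epsilon> power_weight_pos[of 1 x] by (intro mult_right_mono) auto
    also have "E * \<epsilon> = e / 3" using E by (simp add: \<epsilon>_def)
    finally have 1: "N * \<bar>u x t - A * power_weight \<alpha> x\<bar> \<le> e / 3 + E * H * power_weight 1 x" by simp
    have "N * u x t - A = N * (u x t - A * power_weight \<alpha> x) + A * (N * power_weight \<alpha> x - 1)"
      by (simp add: algebra_simps)
    then have "\<bar>N * u x t - A\<bar> \<le> \<bar>N * (u x t - A * power_weight \<alpha> x)\<bar> + \<bar>A * (N * power_weight \<alpha> x - 1)\<bar>"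
      by (metis abs_triangle_ineq)
    also have "\<dots> = N * \<bar>u x t - A * power_weight \<alpha> x\<bar> + A * \<bar>N * power_weight \<alpha> x - 1\<bar>"
      using N A by (simp add: abs_mult)
    finally have "\<bar>N * u x t - A\<bar> < e" using 1 small e unfolding Nw by linarith
    then show "dist (norm x powr \<alpha> * u x t) A < e" by (simp add: N_def dist_real_def)
  qed
qed

end

theorem theorem3p1:
  fixes J u0 :: "real ^ 'n \<Rightarrow> real" and u :: "real ^ 'n \<Rightarrow> real \<Rightarrow> real"
    and \<alpha> A p :: real
  assumes "dispersal_kernel J"
    and "u0 \<in> borel_measurable lebesgue" and "bounded (range u0)" and "\<And>x. u0 x \<ge> 0"
    and "\<alpha> > 0" and "A > 0"
    and "((\<lambda>x. norm x powr \<alpha> * u0 x) \<longlongrightarrow> A) at_infinity"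
    and "p > 1"
    and "is_solution J p u0 u"
  shows "(\<forall>T. \<exists>C. \<forall>x. \<forall>t\<in>{0..T}. u x t \<le> C * (1 + norm x) powr (- \<alpha>)) \<and>
    (\<alpha> < real CARD('n) \<longrightarrow> (\<exists>C. \<forall>x. \<forall>t>0. u x t \<le> C * t powr (- \<alpha> / 2))) \<and>
    (\<alpha> = real CARD('n) \<longrightarrow>
      (\<exists>C. \<forall>x. \<forall>t\<ge>2. u x t \<le> C * t powr (- real CARD('n) / 2) * ln t)) \<and>
    (\<forall>t>0. ((\<lambda>x. norm x powr \<alpha> * u x t) \<longlongrightarrow> A) at_infinity) \<and>
    (\<forall>S. S \<subseteq> {0<..} \<and> bounded S \<longrightarrow>
      uniform_limit S (\<lambda>x t. norm x powr \<alpha> * u x t) (\<lambda>t. A) at_infinity)"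
proof -
  interpret dispersal J by unfold_locales (rule assms(1))
  note sol = assms(9)
  obtain M where M: "\<And>x. u0 x \<le> M"
    using assms(3) unfolding bounded_iff by (auto simp: abs_le_iff)
  obtain C0 where C0: "C0 \<ge> 0" and init: "\<And>x. u0 x \<le> C0 * power_weight \<alpha> x"
    using initial_weight_bound[OF assms(7,5) M assms(4)] by blast
  have unif: "uniform_limit S (\<lambda>x t. norm x powr \<alpha> * u x t) (\<lambda>t. A) at_infinity"
    if S: "S \<subseteq> {0<..}" and bounded_S: "bounded S" for S
  proof -
    obtain T where T: "\<And>t. t \<in> S \<Longrightarrow> \<bar>t\<bar> \<le> T"
      using bounded_S unfolding bounded_iff by auto
    have "S \<subseteq> {0..\<bar>T\<bar>}" using S T by force
    moreover have "uniform_limit {0..\<bar>T\<bar>} (\<lambda>x t. norm x powr \<alpha> * u x t) (\<lambda>t. A) at_infinity"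
      using assms(6) by (intro solution_asymptotics[OF sol assms(5) _ assms(8) _ assms(7) C0 init]) auto
    ultimately show ?thesis by (rule uniform_limit_on_subset[rotated])
  qed
  show ?thesis
  proof (intro conjI allI impI)
    fix T
    have "u x t \<le> C0 * exp ((1 + radius) powr \<alpha> * T) * (1 + norm x) powr (- \<alpha>)" if "t \<in> {0..T}" for x t
    proof -
      have "u x t \<le> C0 * exp ((1 + radius) powr \<alpha> * t) * power_weight \<alpha> x"
        using solution_weight_bound[OF sol _ C0 _ init, of t] assms(5) that by simp
      also have "\<dots> \<le> C0 * exp ((1 + radius) powr \<alpha> * T) * power_weight \<alpha> x"
        using that C0 power_weight_pos[of \<alpha> x]
        by (intro mult_right_mono mult_left_mono exp_le_cancel_iff[THEN iffD2]) auto
      finally show ?thesis by (simp add: power_weight_def)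
    qed
    then show "\<exists>C. \<forall>x. \<forall>t\<in>{0..T}. u x t \<le> C * (1 + norm x) powr (- \<alpha>)" by blast
  next
    assume "\<alpha> < real CARD('n)"
    then show "\<exists>C. \<forall>x. \<forall>t>0. u x t \<le> C * t powr (- \<alpha> / 2)"
      by (rule solution_decay_subcritical[OF sol assms(5) _ C0 init])
  next
    assume "\<alpha> = real CARD('n)"
    then show "\<exists>C. \<forall>x. \<forall>t\<ge>2. u x t \<le> C * t powr (- real CARD('n) / 2) * ln t"
      using solution_decay_critical[OF sol C0] init by simp
  next
    fix t :: real assume "t > 0"
    then have "uniform_limit {t} (\<lambda>x t. norm x powr \<alpha> * u x t) (\<lambda>t. A) at_infinity"
      by (intro unif) auto
    then show "((\<lambda>x. norm x powr \<alpha> * u x t) \<longlongrightarrow> A) at_infinity"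
      by (rule tendsto_uniform_limitI) simp
  next
    fix S :: "real set" assume "S \<subseteq> {0<..} \<and> bounded S"
    then show "uniform_limit S (\<lambda>x t. norm x powr \<alpha> * u x t) (\<lambda>t. A) at_infinity"
      using unif by blast
  qed
qed

end
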